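(* There exists an absolute constant $C>0$ such that for every function $u:\mathbb{N}\to(0,\infty)$ with $u(n)\to\infty$ as $n\to\infty$, $$\inf_{\mu}\Big(\inf\big\{\mathbb{E}_{\mu^N}[\mu(K_N)] : N\geq \exp\big(C(n\ln n)^2u(n)\big)\big\}\Big)\longrightarrow 1\quad\text{as } n\to\infty,$$ where the outer infimum is over all log-concave probability measures $\mu$ on $\mathbb{R}^n$ and $K_N=\mathrm{conv}\{X_1,\ldots,X_N\}$ with $X_1,X_2,\ldots$ independent random points distributed according to $\mu$.
   Context: A log-concave probability measure on $\mathbb{R}^n$ is a Borel probability measure with $\mu(\lambda A+(1-\lambda)B)\geq\mu(A)^\lambda\mu(B)^{1-\lambda}$ for all compact $A,B$ and $\lambda\in(0,1)$, and $\mu(H)<1$ for every hyperplane $H$. *)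

theory Defs
  imports "HOL-Analysis.Analysis" "HOL-Probability.Probability"
begin

text \<open>R^n is modelled as the extensional functions on the index set {..<n}
  (points of the product measure space PiM {..<n} (\<lambda>_. borel)).
  Topology (for compactness) is the product topology on nat \<Rightarrow> real,
  which on this set is the Euclidean topology.\<close>

definition Rn :: "nat \<Rightarrow> (nat \<Rightarrow> real) set" where
  "Rn n = PiE {..<n} (\<lambda>_. UNIV)"

definition Rn_borel :: "nat \<Rightarrow> (nat \<Rightarrow> real) measure" where
  "Rn_borel n = PiM {..<n} (\<lambda>_. borel)"

definition mink_comb :: "nat \<Rightarrow> real \<Rightarrow> (nat \<Rightarrow> real) set \<Rightarrow> (nat \<Rightarrow> real) set \<Rightarrow> (nat \<Rightarrow> real) set" where
  "mink_comb n t A B = {restrict (\<lambda>i. t * a i + (1 - t) * b i) {..<n} | a b. a \<in> A \<and> b \<in> B}"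

definition hyperplane :: "nat \<Rightarrow> (nat \<Rightarrow> real) \<Rightarrow> real \<Rightarrow> (nat \<Rightarrow> real) set" where
  "hyperplane n a b = {x \<in> Rn n. (\<Sum>i<n. a i * x i) = b}"

definition log_concave_measure :: "nat \<Rightarrow> (nat \<Rightarrow> real) measure \<Rightarrow> bool" where
  "log_concave_measure n \<mu> \<longleftrightarrow>
     prob_space \<mu> \<and> sets \<mu> = sets (Rn_borel n) \<and>
     (\<forall>A B t. compact A \<longrightarrow> compact B \<longrightarrow> A \<subseteq> Rn n \<longrightarrow> B \<subseteq> Rn n \<longrightarrow> 0 < t \<longrightarrow> t < 1 \<longrightarrow>
        measure \<mu> (mink_comb n t A B) \<ge> measure \<mu> A powr t * measure \<mu> B powr (1 - t)) \<and>
     (\<forall>a b. (\<exists>i<n. a i \<noteq> 0) \<longrightarrow> measure \<mu> (hyperplane n a b) < 1)"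

definition conv_pts :: "nat \<Rightarrow> nat \<Rightarrow> (nat \<Rightarrow> nat \<Rightarrow> real) \<Rightarrow> (nat \<Rightarrow> real) set" where
  "conv_pts n N X = {restrict (\<lambda>i. \<Sum>j<N. w j * X j i) {..<n} | w.
      (\<forall>j<N. 0 \<le> w j) \<and> (\<Sum>j<N. w j) = 1}"

definition expected_hull_measure :: "nat \<Rightarrow> (nat \<Rightarrow> real) measure \<Rightarrow> nat \<Rightarrow> real" where
  "expected_hull_measure n \<mu> N =
     integral\<^sup>L (PiM {..<N} (\<lambda>_. \<mu>)) (\<lambda>X. measure \<mu> (conv_pts n N X))"

end

theory Submission
  imports Defs "HOL-Real_Asymp.Real_Asymp"
begin

text \<open>
  Normalise \<open>\<mu>\<close> by affine forms \<open>\<phi> 0, \<dots>, \<phi> (n - 1)\<close> that are orthonormal in \<open>L\<^sup>2(\<mu>)\<close>. All but a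
  small part of \<open>\<mu>\<close> then lives on a cube of polynomial size in the \<open>\<phi>\<close>-coordinates, which is
  cut into \<open>exp (O (n ln n))\<close> cells of polynomially small side; cells of too small measure are
  discarded. Log-concavity says that the measure of a translated cell is a log-concave function of
  the translation, so a cell near the barycentre is at least as heavy as the lightest kept cell.
  Contracting the kept cells slightly towards it by a factor \<open>1 - \<tau>\<close> costs almost no measure, and
  every halfspace meeting the contracted set contains one of the cells
  \<open>(1 - \<tau>) Q + \<tau> Q'\<close> with \<open>Q\<close>, \<open>Q'\<close> kept, because one-dimensional marginals of variance \<open>1\<close> give
  mass bounded below to \<open>[s, \<infinity>)\<close>. These cells have measure at least \<open>exp (- O (n ln n))\<close>, so a sample of
  size \<open>exp ((n ln n)\<^sup>2)\<close> hits all of them with probability close to \<open>1\<close>, and then its convex hull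
  contains the contracted set.
\<close>

section \<open>Marginals of log-concave measures\<close>

text \<open>The obstacle is uniformity: the hull contains a point only if every halfspace through it
  is hit, and there are uncountably many. The boxes \<open>(1 - \<tau>) Q + \<tau> Q'\<close> reduce
  this to a union bound over at most \<open>(2 J)^(2 n)\<close> events. No density is used, only the
  inequality for sets. For the cells it says that the corners of boxes with measure at least
  \<open>\<eta>\<close> form a convex set, so \<open>\<eta>\<close> is inherited by every target box
  and by a box at a finite average of kept corners. The contraction loses the factor
  \<open>\<eta> powr \<tau>\<close>. As \<open>\<eta>\<close> is at least
  \<open>exp (- 8 n ln n)\<close>, the choice \<open>\<tau> = n^(-3)\<close> makes this factor tend
  to 1. The cell side must then be small against \<open>\<tau> / n\<close>, which still leaves
  polynomially many cells per axis and so does not spoil the bound on \<open>\<eta>\<close>. The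
  level \<open>s\<close> has to be independent of \<open>n\<close> and \<open>\<mu>\<close>; it
  comes from exponential tails of marginals, which bound the fourth moment in terms of the
  second.\<close>

definition affine_form :: "nat \<Rightarrow> (nat \<Rightarrow> real) \<Rightarrow> real \<Rightarrow> (nat \<Rightarrow> real) \<Rightarrow> real" where
  "affine_form n a b x = (\<Sum>i<n. a i * x i) + b"

lemma affine_form_comb:
  "affine_form n a b (restrict (\<lambda>i. t * x i + (1 - t) * y i) {..<n}) =
     t * affine_form n a b x + (1 - t) * affine_form n a b y"
  by (simp add: affine_form_def sum_distrib_left sum.distrib sum_subtractf algebra_simps)

lemma affine_form_uminus: "affine_form n (\<lambda>i. - a i) (- b) x = - affine_form n a b x"
  by (simp add: affine_form_def sum_negf)

lemma continuous_on_affine_form [continuous_intros]: "continuous_on S (affine_form n a b)"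
  unfolding affine_form_def
  by (intro continuous_on_add continuous_on_sum continuous_on_mult continuous_on_const
      continuous_on_subset[OF continuous_on_product_coordinates subset_UNIV])

lemma Rn_eq: "Rn n = {x. \<forall>i. n \<le> i \<longrightarrow> x i = undefined}"
  by (simp add: Rn_def PiE_def extensional_def not_less)

lemma closed_Rn: "closed (Rn n)"
  unfolding Rn_eq
  by (intro closed_Collect_all closed_Collect_imp closed_Collect_eq open_Collect_const
      continuous_on_const continuous_on_product_coordinates)

lemma compact_cube: "compact (PiE {..<n::nat} (\<lambda>_. {- c..c::real}))"
proof -
  \<comment> \<open>Coordinates outside \<open>{..<n}\<close> become singleton factors, so
    Tychonoff's theorem on the full product applies.\<close>
  have "PiE {..<n} (\<lambda>_. {- c..c}) = PiE UNIV (\<lambda>i. if i < n then {- c..c} else {undefined})"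
    (is "?L = ?R")
  proof (intro set_eqI iffI)
    fix x assume x: "x \<in> ?L"
    have "x i \<in> (if i < n then {- c..c} else {undefined})" for i
      using PiE_mem[OF x, of i] PiE_arb[OF x, of i] by simp
    then show "x \<in> ?R" unfolding PiE_UNIV_domain by (intro Pi_I)
  next
    fix x assume "x \<in> ?R"
    then have x: "x i \<in> (if i < n then {- c..c} else {undefined})" for i
      using PiE_mem[of x UNIV _ i] by blast
    have "x i \<in> {- c..c}" if "i < n" for i using x[of i] that by simp
    moreover have "x i = undefined" if "i \<notin> {..<n}" for i using x[of i] that by simp
    ultimately show "x \<in> ?L" by (intro PiE_I) simp_all
  qed
  moreover have "compactin (product_topology (\<lambda>_. euclidean) UNIV)
      (PiE UNIV (\<lambda>i::nat. if i < n then {- c..c} else {undefined}))"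
    by (subst compactin_PiE) auto
  ultimately show ?thesis
    by (simp add: euclidean_product_topology)
qed

section \<open>Log-concavity for closed sets and halfspaces\<close>

locale log_concave_space = prob_space M for M :: "(nat \<Rightarrow> real) measure" +
  fixes n :: nat
  assumes lc: "log_concave_measure n M"
begin

lemma sets_M [measurable_cong]: "sets M = sets (PiM {..<n} (\<lambda>_. borel))"
  using lc by (simp add: log_concave_measure_def Rn_borel_def)

lemma space_M: "space M = Rn n"
  using sets_eq_imp_space_eq[OF sets_M] by (simp add: space_PiM Rn_def)

lemma lc_compact:
  assumes "compact A" "compact B" "A \<subseteq> Rn n" "B \<subseteq> Rn n" "0 < t" "t < 1"
  shows "prob A powr t * prob B powr (1 - t) \<le> prob (mink_comb n t A B)"
  using lc assms by (auto simp: log_concave_measure_def)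

lemma hyperplane_lt: "i < n \<Longrightarrow> a i \<noteq> 0 \<Longrightarrow> prob (hyperplane n a b) < 1"
  using lc by (auto simp: log_concave_measure_def)

lemma measurable_affine_form [measurable]: "affine_form n a b \<in> borel_measurable M"
  unfolding affine_form_def by measurable

text \<open>Exhausting by the cubes \<open>Q k\<close> passes from compact to closed sets. The event
  \<open>S\<close> stands in for the Minkowski combination, which need not be closed when
  \<open>A\<close> and \<open>B\<close> are unbounded.\<close>

lemma lc_closed:
  assumes A: "closed A" "A \<in> events" and B: "closed B" "B \<in> events"
    and t: "0 < t" "t < 1" and S: "S \<in> events"
    and sub: "\<And>x y. x \<in> A \<Longrightarrow> y \<in> B \<Longrightarrow> restrict (\<lambda>i. t * x i + (1 - t) * y i) {..<n} \<in> S"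
  shows "prob A powr t * prob B powr (1 - t) \<le> prob S"
proof -
  define Q where "Q k = PiE {..<n} (\<lambda>_. {- real k..real k})" for k
  have Q: "compact (Q k)" "Q k \<in> events" for k
    using compact_cube[of n "real k"] by (auto simp: Q_def sets_M intro!: sets_PiM_I_finite)
  have Qinc: "incseq Q"
    unfolding incseq_def Q_def by (auto intro!: PiE_mono simp: atLeastatMost_subset_iff)
  have Qun: "(\<Union>k. Q k) = Rn n"
  proof (intro equalityI subsetI)
    fix x assume x: "x \<in> Rn n"
    obtain k :: nat where k: "(\<Sum>i<n. \<bar>x i\<bar>) \<le> real k" using real_arch_simple by blast
    have "\<bar>x i\<bar> \<le> real k" if "i < n" for i
      using member_le_sum[of i "{..<n}" "\<lambda>i. \<bar>x i\<bar>"] that k by auto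
    then have "x \<in> Q k" using x by (fastforce simp: Q_def Rn_def PiE_iff abs_le_iff)
    then show "x \<in> (\<Union>k. Q k)" by blast
  qed (auto simp: Q_def Rn_def PiE_iff)
  have lim: "(\<lambda>k. prob (C \<inter> Q k)) \<longlonglongrightarrow> prob C" if "C \<in> events" for C
  proof -
    have "(\<lambda>k. prob (C \<inter> Q k)) \<longlonglongrightarrow> prob (\<Union>k. C \<inter> Q k)"
      using that Q(2) monoD[OF Qinc] by (intro finite_Lim_measure_incseq) (auto intro!: monoI)
    moreover have "(\<Union>k. C \<inter> Q k) = C"
      using Qun sets.sets_into_space[OF that] space_M by auto
    ultimately show ?thesis by simp
  qed
  have "prob (A \<inter> Q k) powr t * prob (B \<inter> Q k) powr (1 - t) \<le> prob S" for k
  proof -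
    have "prob (A \<inter> Q k) powr t * prob (B \<inter> Q k) powr (1 - t)
        \<le> prob (mink_comb n t (A \<inter> Q k) (B \<inter> Q k))"
      using A B Q t sets.sets_into_space[of A M] sets.sets_into_space[of B M] space_M
      by (intro lc_compact closed_Int_compact) auto
    also have "\<dots> \<le> prob S"
    \<comment> \<open>\<open>measure\<close> is 0 off the sigma-algebra, so a non-measurable
      combination satisfies the bound trivially.\<close>
    proof (cases "mink_comb n t (A \<inter> Q k) (B \<inter> Q k) \<in> events")
      case True
      then show ?thesis using sub by (intro finite_measure_mono S) (auto simp: mink_comb_def)
    qed (simp add: measure_notin_sets)
    finally show ?thesis .
  qed
  moreover have "(\<lambda>k. prob (A \<inter> Q k) powr t * prob (B \<inter> Q k) powr (1 - t)) \<longlonglongrightarrow>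
      prob A powr t * prob B powr (1 - t)"
    using t A B by (intro tendsto_mult tendsto_powr' lim tendsto_const) auto
  ultimately show ?thesis
    by (intro LIMSEQ_le_const2) auto
qed

text \<open>The tail function of every one-dimensional marginal is log-concave; this is the form
  that tail bounds need.\<close>

lemma lc_halfspace:
  assumes "0 < t" "t < 1" "z \<le> t * x + (1 - t) * y"
  shows "prob {w \<in> space M. x \<le> affine_form n a b w} powr t *
    prob {w \<in> space M. y \<le> affine_form n a b w} powr (1 - t)
    \<le> prob {w \<in> space M. z \<le> affine_form n a b w}"
proof (rule lc_closed)
  have cl: "closed {w \<in> space M. c \<le> affine_form n a b w}" for c
    using closed_Rn closed_Collect_le[OF continuous_on_const continuous_on_affine_form, of c n a b]
    unfolding space_M Collect_conj_eq by auto
  show "closed {w \<in> space M. x \<le> affine_form n a b w}"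
    "closed {w \<in> space M. y \<le> affine_form n a b w}"
    using cl by auto
  fix v w assume "v \<in> {w \<in> space M. x \<le> affine_form n a b w}"
    "w \<in> {w \<in> space M. y \<le> affine_form n a b w}"
  then have "t * x + (1 - t) * y \<le> t * affine_form n a b v + (1 - t) * affine_form n a b w"
    using assms by (intro add_mono mult_left_mono) auto
  then show "restrict (\<lambda>i. t * v i + (1 - t) * w i) {..<n} \<in> {w \<in> space M. z \<le> affine_form n a b w}"
    using assms(3) unfolding mem_Collect_eq affine_form_comb by (auto simp: space_M Rn_def)
qed (use assms in auto)

section \<open>Exponential tails and fourth moments of marginals\<close>

lemma tail_one_sided:
  assumes c: "0 < c" and q: "prob {w \<in> space M. c \<le> \<bar>affine_form n a b w\<bar>} \<le> 1/4" and k: "0 < k"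
  shows "prob {w \<in> space M. real k * c \<le> affine_form n a b w} \<le> (3/5) ^ (k + 1)"
proof -
  define g where "g x = prob {w \<in> space M. x \<le> affine_form n a b w}" for x
  have g1: "g c \<le> 1/4"
    unfolding g_def using c by (intro order_trans[OF finite_measure_mono q]) auto
  have "prob (space M - {w \<in> space M. c \<le> \<bar>affine_form n a b w\<bar>}) \<le> g (- c)"
    unfolding g_def using c by (intro finite_measure_mono) auto
  then have g2: "3/4 \<le> g (- c)"
    using q by (subst (asm) prob_compl) auto
  show ?thesis
  proof (cases "k = 1")
    case True
    then show ?thesis using g1 by (simp add: g_def power2_eq_square)
  next
    case False
    \<comment> \<open>Borell's argument: \<open>t\<close> writes \<open>c\<close> as a combination
      of \<open>k c\<close> and \<open>- c\<close>. With tail at least 3/4 at \<open>- c\<close> and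
      at most 1/4 at \<open>c\<close>, the tail at \<open>k c\<close> raised to the power
      \<open>t\<close> is at most 1/3. The base 3/5 results from \<open>1/3 < (3/5)^2\<close> and
      \<open>(k + 1) t = 2\<close>.\<close>
    define t where "t = 2 / (real k + 1)"
    have t: "0 < t" "t < 1" using k False by (auto simp: t_def)
    have eq: "t * (real k * c) + (1 - t) * (- c) = c"
      by (simp add: t_def divide_simps) (simp add: algebra_simps)
    define p where "p = g (real k * c)"
    have p0: "0 \<le> p" by (simp add: p_def g_def)
    have "p powr t * g (- c) powr (1 - t) \<le> g c"
      unfolding p_def g_def by (rule lc_halfspace) (use t eq in auto)
    moreover have "3/4 \<le> g (- c) powr (1 - t)"
    proof -
      have "3/4 = (3/4::real) powr 1" by simp
      also have "\<dots> \<le> (3/4) powr (1 - t)" using t by (intro powr_mono') auto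
      also have "\<dots> \<le> g (- c) powr (1 - t)" using g2 t by (intro powr_mono2) auto
      finally show ?thesis .
    qed
    ultimately have "p powr t * (3/4) \<le> 1/4"
      using g1 by (smt (verit) mult_left_mono powr_ge_zero)
    then have pt: "p powr t \<le> 1/3" by simp
    show ?thesis
    proof (rule ccontr)
      assume "\<not> ?thesis"
      then have "(3/5) ^ (k + 1) < p" by (simp add: p_def g_def)
      then have "((3/5) ^ (k + 1)) powr t < p powr t"
        using t by (intro powr_less_mono2) auto
      also have "((3/5::real) ^ (k + 1)) powr t = (3/5) powr 2"
      proof -
        have "real (k + 1) * t = 2" by (simp add: t_def field_simps)
        moreover have "(3/5::real) ^ (k + 1) = (3/5) powr real (k + 1)"
          by (rule powr_realpow[symmetric]) simp
        ultimately show ?thesis by (simp only: powr_powr)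
      qed
      finally show False using pt by (simp add: power2_eq_square)
    qed
  qed
qed

lemma tail_two_sided:
  assumes c: "0 < c" and q: "prob {w \<in> space M. c \<le> \<bar>affine_form n a b w\<bar>} \<le> 1/4"
  shows "prob {w \<in> space M. real k * c \<le> \<bar>affine_form n a b w\<bar>} \<le> 2 * (3/5) ^ (k + 1)"
proof (cases "k = 0")
  \<comment> \<open>Here the claimed bound is 6/5, hence trivial.\<close>
  case True
  then show ?thesis using prob_le_1[of "space M"] by (auto simp: prob_space)
next
  case False
  let ?P = "{w \<in> space M. real k * c \<le> affine_form n a b w}"
  let ?N = "{w \<in> space M. real k * c \<le> affine_form n (\<lambda>i. - a i) (- b) w}"
  have "prob {w \<in> space M. real k * c \<le> \<bar>affine_form n a b w\<bar>} \<le> prob (?P \<union> ?N)"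
    by (intro finite_measure_mono) (auto simp: affine_form_uminus)
  also have "\<dots> \<le> prob ?P + prob ?N"
    by (intro measure_Un_le) auto
  also have "\<dots> \<le> (3/5) ^ (k + 1) + (3/5) ^ (k + 1)"
    using False c q by (intro add_mono tail_one_sided) (auto simp: affine_form_uminus)
  finally show ?thesis by simp
qed

end

text \<open>The tail bound at level \<open>k c\<close> summed against \<open>(k + 1)^4\<close>: a
  bound for the fourth moment in units of \<open>c^4\<close>, independent of measure and
  dimension.\<close>

definition fourth_moment_const :: real where
  "fourth_moment_const = (\<Sum>k. real (k + 1) ^ 4 * (2 * (3/5) ^ (k + 1)))"

lemma summable_fourth_moment: "summable (\<lambda>k. real (k + 1) ^ 4 * (2 * (3/5) ^ (k + 1)))"
proof -
  \<comment> \<open>From \<open>k = 9\<close> on, the fourth powers grow by a factor of at most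
    \<open>(11/10)^4 <= 3/2\<close>, and \<open>3/2 * 3/5 = 9/10\<close>.\<close>
  have "real (Suc k + 1) ^ 4 * (2 * (3/5) ^ (Suc k + 1)) \<le> 9/10 * (real (k + 1) ^ 4 * (2 * (3/5) ^ (k + 1)))"
    if "9 \<le> k" for k
  proof -
    have "real (Suc k + 1) ^ 4 \<le> (11/10 * real (k + 1)) ^ 4"
      using that by (intro power_mono) auto
    also have "\<dots> \<le> 3/2 * real (k + 1) ^ 4"
      unfolding power_mult_distrib by (intro mult_right_mono) (auto simp: power4_eq_xxxx)
    finally have "real (Suc k + 1) ^ 4 * (2 * (3/5) ^ (Suc k + 1)) \<le> 3/2 * real (k + 1) ^ 4 * (2 * (3/5) ^ (Suc k + 1))"
      by (intro mult_right_mono) auto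
    then show ?thesis by simp
  qed
  then show ?thesis by (intro summable_ratio_test[of "9/10" 9]) auto
qed

context log_concave_space
begin

lemma fourth_moment_bound:
  assumes c: "0 < c" and q: "prob {w \<in> space M. c \<le> \<bar>affine_form n a b w\<bar>} \<le> 1/4"
  shows "integrable M (\<lambda>w. affine_form n a b w ^ 4)"
    and "expectation (\<lambda>w. affine_form n a b w ^ 4) \<le> c ^ 4 * fourth_moment_const"
proof -
  let ?Y = "affine_form n a b"
  define A where "A k = {w \<in> space M. real k * c \<le> \<bar>?Y w\<bar>}" for k
  have A [measurable]: "A k \<in> events" for k unfolding A_def by measurable
  \<comment> \<open>The single term \<open>k = floor (|Y| / c)\<close> suffices; adding the others
    replaces shells by the nested sets \<open>A k\<close>, whose measures the tail bound
    controls.\<close>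
  have pt: "ennreal (?Y w ^ 4) \<le> (\<Sum>k. ennreal (c ^ 4 * real (k + 1) ^ 4) * indicator (A k) w)"
    if "w \<in> space M" for w
  proof -
    define k where "k = nat \<lfloor>\<bar>?Y w\<bar> / c\<rfloor>"
    have k: "real k * c \<le> \<bar>?Y w\<bar>" "\<bar>?Y w\<bar> \<le> c * real (k + 1)"
    proof -
      have "real k = of_int \<lfloor>\<bar>?Y w\<bar> / c\<rfloor>" using c by (simp add: k_def)
      then have "real k \<le> \<bar>?Y w\<bar> / c" "\<bar>?Y w\<bar> / c \<le> real k + 1" by linarith+
      then show "real k * c \<le> \<bar>?Y w\<bar>" "\<bar>?Y w\<bar> \<le> c * real (k + 1)"
        using c by (simp_all add: field_simps)
    qed
    have "?Y w ^ 4 = \<bar>?Y w\<bar> ^ 4" by (simp add: power_even_abs)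
    also have "\<dots> \<le> (c * real (k + 1)) ^ 4" using k by (intro power_mono) auto
    finally have "ennreal (?Y w ^ 4) \<le> ennreal (c ^ 4 * real (k + 1) ^ 4) * indicator (A k) w"
      using that k by (auto simp: A_def power_mult_distrib intro!: ennreal_leI)
    also have "\<dots> \<le> (\<Sum>k. ennreal (c ^ 4 * real (k + 1) ^ 4) * indicator (A k) w)"
      using sum_le_suminf[OF summableI, of "{k}" "\<lambda>k. ennreal (c ^ 4 * real (k + 1) ^ 4) * indicator (A k) w"]
      by (simp del: sum_mult_indicator)
    finally show ?thesis .
  qed
  have "(\<integral>\<^sup>+w. ennreal (?Y w ^ 4) \<partial>M)
      \<le> (\<integral>\<^sup>+w. (\<Sum>k. ennreal (c ^ 4 * real (k + 1) ^ 4) * indicator (A k) w) \<partial>M)"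
    using pt by (intro nn_integral_mono)
  also have "\<dots> = (\<Sum>k. \<integral>\<^sup>+w. ennreal (c ^ 4 * real (k + 1) ^ 4) * indicator (A k) w \<partial>M)"
    by (intro nn_integral_suminf) auto
  also have "\<dots> = (\<Sum>k. ennreal (c ^ 4 * real (k + 1) ^ 4 * prob (A k)))"
    using c by (intro suminf_cong) (simp add: nn_integral_cmult emeasure_eq_measure ennreal_mult)
  also have "\<dots> \<le> (\<Sum>k. ennreal (c ^ 4 * (real (k + 1) ^ 4 * (2 * (3/5) ^ (k + 1)))))"
    using c tail_two_sided[OF c q]
    by (intro suminf_le ennreal_leI) (auto simp: A_def mult.assoc intro!: mult_left_mono)
  also have "\<dots> = ennreal (\<Sum>k. c ^ 4 * (real (k + 1) ^ 4 * (2 * (3/5) ^ (k + 1))))"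
    using c by (intro suminf_ennreal2 summable_mult summable_fourth_moment) auto
  also have "\<dots> = ennreal (c ^ 4 * fourth_moment_const)"
    unfolding fourth_moment_const_def by (subst suminf_mult[OF summable_fourth_moment]) simp
  finally have bd: "(\<integral>\<^sup>+w. ennreal (?Y w ^ 4) \<partial>M) \<le> ennreal (c ^ 4 * fourth_moment_const)" .
  have C0: "0 \<le> fourth_moment_const"
    unfolding fourth_moment_const_def by (intro suminf_nonneg summable_fourth_moment) auto
  show int: "integrable M (\<lambda>w. ?Y w ^ 4)"
    using bd by (intro integrableI_nonneg) (auto intro: le_less_trans)
  show "expectation (\<lambda>w. ?Y w ^ 4) \<le> c ^ 4 * fourth_moment_const"
    using bd nn_integral_eq_integral[OF int] C0 c by (simp add: ennreal_le_iff)
qed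

text \<open>Supplies a level for every affine form before any moment is known to be finite; all
  integrability facts below start from it.\<close>

lemma tail_quarter: "\<exists>c>0. prob {w \<in> space M. c \<le> \<bar>affine_form n a b w\<bar>} \<le> 1/4"
proof -
  let ?A = "\<lambda>k::nat. {w \<in> space M. real k \<le> \<bar>affine_form n a b w\<bar>}"
  have "(\<lambda>k. prob (?A k)) \<longlonglongrightarrow> prob (\<Inter>k. ?A k)"
    by (intro finite_Lim_measure_decseq) (auto simp: decseq_def)
  moreover have "(\<Inter>k. ?A k) = {}"
    by auto (metis linorder_not_less reals_Archimedean2)
  ultimately have "(\<lambda>k. prob (?A k)) \<longlonglongrightarrow> 0" by simp
  then have "eventually (\<lambda>k. prob (?A k) < 1/4) sequentially"
    by (rule order_tendstoD) simp
  then have "eventually (\<lambda>k. prob (?A k) < 1/4 \<and> 0 < k) sequentially"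
    by (intro eventually_conj eventually_gt_at_top)
  then obtain k where "prob (?A k) < 1/4" "0 < k"
    by (auto simp: eventually_sequentially)
  then show ?thesis by (intro exI[of _ "real k"]) auto
qed

lemma integrable_power4: "integrable M (\<lambda>w. affine_form n a b w ^ 4)"
  using tail_quarter fourth_moment_bound(1) by blast

lemma integrable_square [simp]: "integrable M (\<lambda>w. (affine_form n a b w)\<^sup>2)"
proof (rule Bochner_Integration.integrable_bound)
  show "integrable M (\<lambda>w. 1 + affine_form n a b w ^ 4)"
    by (intro Bochner_Integration.integrable_add integrable_power4) auto
  have "y\<^sup>2 \<le> 1 + y ^ 4" for y :: real
  proof -
    have "0 \<le> (y\<^sup>2 - 1)\<^sup>2 + y\<^sup>2" by simp
    also have "\<dots> = 1 + y ^ 4 - y\<^sup>2" by (simp add: power2_eq_square power4_eq_xxxx algebra_simps)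
    finally show ?thesis by simp
  qed
  then show "AE w in M. norm ((affine_form n a b w)\<^sup>2) \<le> norm (1 + affine_form n a b w ^ 4)"
    by (intro AE_I2) (simp add: abs_of_nonneg)
qed auto

lemma integrable_affine_form [simp]: "integrable M (affine_form n a b)"
  using square_integrable_imp_integrable[of "affine_form n a b"] integrable_square by simp

lemma integrable_affine_form_mult [simp]:
  "integrable M (\<lambda>w. affine_form n a b w * affine_form n a' b' w)"
proof (rule Bochner_Integration.integrable_bound)
  show "integrable M (\<lambda>w. (affine_form n a b w)\<^sup>2 + (affine_form n a' b' w)\<^sup>2)"
    by (intro Bochner_Integration.integrable_add) auto
  have "\<bar>x * y\<bar> \<le> x\<^sup>2 + y\<^sup>2" for x y :: real
    using sum_squares_bound[of "\<bar>x\<bar>" "\<bar>y\<bar>"] abs_ge_zero[of "x * y"]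
    unfolding abs_mult power2_abs by linarith
  then show "AE w in M. norm (affine_form n a b w * affine_form n a' b' w)
      \<le> norm ((affine_form n a b w)\<^sup>2 + (affine_form n a' b' w)\<^sup>2)"
    by (intro AE_I2) simp
qed auto

text \<open>A reverse Hoelder inequality: Chebyshev at level 2 gives tail 1/4, so the moment bound
  applies with \<open>c = 2\<close>, whence \<open>16 = 2^4\<close>.\<close>

lemma fourth_moment_le:
  assumes "expectation (\<lambda>w. (affine_form n a b w)\<^sup>2) = 1"
  shows "expectation (\<lambda>w. affine_form n a b w ^ 4) \<le> 16 * fourth_moment_const"
proof -
  have "prob {w \<in> space M. 4 \<le> (affine_form n a b w)\<^sup>2} \<le> 1 / 4"
    using integral_Markov_inequality_measure[of M "\<lambda>w. (affine_form n a b w)\<^sup>2" "{}" 4] assms by simp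
  moreover have "{w \<in> space M. 4 \<le> (affine_form n a b w)\<^sup>2} = {w \<in> space M. 2 \<le> \<bar>affine_form n a b w\<bar>}"
    using abs_le_square_iff[of 2] by auto
  ultimately show ?thesis
    using fourth_moment_bound(2)[of 2 a b] by simp
qed

end

text \<open>A function with unit second moment and bounded fourth moment cannot have small first absolute
  moment, and a centred function has half of that moment on its positive part.\<close>

lemma exists_one_sided_const:
  "\<exists>q::nat. 0 < q \<and> (\<forall>M n a b. log_concave_space M n \<longrightarrow>
     integral\<^sup>L M (affine_form n a b) = 0 \<longrightarrow> integral\<^sup>L M (\<lambda>w. (affine_form n a b w)\<^sup>2) = 1 \<longrightarrow>
     1 / (real q)\<^sup>2 \<le> measure M {w \<in> space M. 1 / real q \<le> affine_form n a b w})"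
proof -
  \<comment> \<open>Beyond \<open>T\<close> one has \<open>Y^2 <= Y^4 / T^2\<close>. As
    \<open>16 * fourth_moment_const <= T / 2 <= T^2 / 2\<close>, that part takes at most 1/2 of the
    unit second moment, leaving \<open>1/2 <= T * E|Y|\<close>.\<close>
  define T where "T = 1 + 32 * fourth_moment_const"
  have C0: "0 \<le> fourth_moment_const"
    unfolding fourth_moment_const_def by (intro suminf_nonneg summable_fourth_moment) auto
  have T: "1 \<le> T" using C0 by (simp add: T_def)
  \<comment> \<open>With \<open>s = 1 / q <= 1 / (8 T)\<close> the bound on \<open>E|Y|\<close>
    becomes \<open>4 s <= E|Y|\<close>. An integer \<open>q\<close> lets the number of grid cells be
    an integer formula in \<open>q\<close> and \<open>n\<close>.\<close>
  obtain q :: nat where q: "8 * T \<le> real q" using real_arch_simple by blast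
  define s where "s = 1 / real q"
  have q0: "0 < real q" using q T by linarith
  have s0: "0 < s" using q0 by (simp add: s_def)
  have sT: "8 * s * T \<le> 1" using q q0 by (simp add: s_def field_simps)
  have "s\<^sup>2 \<le> measure M {w \<in> space M. s \<le> affine_form n a b w}"
    if L: "log_concave_space M n" and E1: "integral\<^sup>L M (affine_form n a b) = 0"
      and E2: "integral\<^sup>L M (\<lambda>w. (affine_form n a b w)\<^sup>2) = 1" for M n a b
  proof -
    interpret log_concave_space M n by fact
    let ?Y = "affine_form n a b"
    let ?A = "{w \<in> space M. s \<le> ?Y w}"
    have [simp]: "integrable M (indicat_real ?A)"
      by (intro integrable_real_indicator) (auto simp: emeasure_eq_measure)
    have "1 \<le> expectation (\<lambda>w. T * \<bar>?Y w\<bar> + ?Y w ^ 4 / T\<^sup>2)"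
      unfolding E2[symmetric]
    proof (rule integral_mono)
      fix w
      show "(?Y w)\<^sup>2 \<le> T * \<bar>?Y w\<bar> + ?Y w ^ 4 / T\<^sup>2"
      proof (cases "\<bar>?Y w\<bar> \<le> T")
        case True
        then have "\<bar>?Y w\<bar> * \<bar>?Y w\<bar> \<le> T * \<bar>?Y w\<bar>" by (intro mult_right_mono) auto
        then have "(?Y w)\<^sup>2 \<le> T * \<bar>?Y w\<bar>" by (simp add: power2_eq_square)
        moreover have "0 \<le> ?Y w ^ 4 / T\<^sup>2" by simp
        ultimately show ?thesis by linarith
      next
        case False
        then have "T\<^sup>2 \<le> (?Y w)\<^sup>2" using T by (metis abs_le_square_iff abs_of_nonneg linear order_trans zero_le_one)
        then have "(?Y w)\<^sup>2 * T\<^sup>2 \<le> ?Y w ^ 4" 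
          using mult_left_mono[of "T\<^sup>2" "(?Y w)\<^sup>2" "(?Y w)\<^sup>2"] by (simp add: power4_eq_xxxx power2_eq_square mult.assoc)
        then have "(?Y w)\<^sup>2 \<le> ?Y w ^ 4 / T\<^sup>2" using T by (simp add: pos_le_divide_eq)
        moreover have "0 \<le> T * \<bar>?Y w\<bar>" using T by simp
        ultimately show ?thesis by linarith
      qed
    qed (auto intro!: integrable_power4)
    also have "\<dots> = T * expectation (\<lambda>w. \<bar>?Y w\<bar>) + expectation (\<lambda>w. ?Y w ^ 4) / T\<^sup>2"
      by (subst Bochner_Integration.integral_add) (auto intro!: integrable_power4)
    also have "\<dots> \<le> T * expectation (\<lambda>w. \<bar>?Y w\<bar>) + 1/2"
    proof -
      have "expectation (\<lambda>w. ?Y w ^ 4) \<le> 16 * fourth_moment_const" by (rule fourth_moment_le[OF E2])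
      also have "\<dots> \<le> T / 2" by (simp add: T_def)
      also have "\<dots> \<le> T\<^sup>2 / 2" using T by (simp add: power2_eq_square)
      finally show ?thesis using T by (simp add: field_simps)
    qed
    finally have "1/2 \<le> T * expectation (\<lambda>w. \<bar>?Y w\<bar>)" by simp
    then have "s * (1/2) \<le> s * (T * expectation (\<lambda>w. \<bar>?Y w\<bar>))" using s0 by (intro mult_left_mono) auto
    moreover have "8 * s * T * expectation (\<lambda>w. \<bar>?Y w\<bar>) \<le> 1 * expectation (\<lambda>w. \<bar>?Y w\<bar>)"
      using sT by (intro mult_right_mono) auto
    ultimately have absE: "4 * s \<le> expectation (\<lambda>w. \<bar>?Y w\<bar>)" by simp
    have "expectation (\<lambda>w. \<bar>?Y w\<bar>) = expectation (\<lambda>w. \<bar>?Y w\<bar> + ?Y w)"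
      using E1 by simp
    \<comment> \<open>Below \<open>s\<close> the integrand \<open>|Y| + Y\<close> is at most
      \<open>2 s\<close>; above, it is \<open>2 Y <= s Y^2 + 1 / s\<close>. Hence
      \<open>4 s <= 3 s + prob ?A / s\<close>.\<close>
    also have "\<dots> \<le> expectation (\<lambda>w. 2 * s + s * (?Y w)\<^sup>2 + indicator ?A w / s)"
    proof (rule integral_mono)
      fix w assume w: "w \<in> space M"
      show "\<bar>?Y w\<bar> + ?Y w \<le> 2 * s + s * (?Y w)\<^sup>2 + indicator ?A w / s"
      proof (cases "s \<le> ?Y w")
        case True
        have "0 \<le> (s * ?Y w - 1)\<^sup>2 / s" using s0 by simp
        also have "\<dots> = s * (?Y w)\<^sup>2 + 1 / s - 2 * ?Y w"
          using s0 by (simp add: power2_eq_square field_simps)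
        finally show ?thesis using True w s0 by simp
      next
        case False
        then have "\<bar>?Y w\<bar> + ?Y w \<le> 2 * s" using s0 by linarith
        moreover have "0 \<le> s * (?Y w)\<^sup>2" "0 \<le> indicator ?A w / s" using s0 by simp_all
        ultimately show ?thesis by linarith
      qed
    qed (auto intro!: Bochner_Integration.integrable_add integrable_divide_zero)
    also have "\<dots> = 2 * s + s * 1 + prob ?A / s"
      using E2 by (simp add: prob_space)
    finally have "s \<le> prob ?A / s" using absE by simp
    then show ?thesis using s0 by (simp add: field_simps power2_eq_square)
  qed
  then show ?thesis using q0 by (intro exI[of _ q]) (auto simp: s_def power_one_over)
qed

section \<open>Random convex hulls\<close>

text \<open>The normal \<open>\<theta>\<close> points from the nearest point of the hull to
  \<open>z\<close>. The distance is minimised over the compact simplex of weights instead of over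
  the hull. For \<open>N = 0\<close> the claim is vacuous.\<close>

lemma conv_pts_separation:
  assumes z: "z \<in> Rn n" and nz: "z \<notin> conv_pts n N X"
  shows "\<exists>\<theta>. \<forall>j<N. (\<Sum>i<n. \<theta> i * X j i) < (\<Sum>i<n. \<theta> i * z i)"
proof (cases "N = 0")
  case False
  define W where "W = PiE {..<N} (\<lambda>_. {- 1..1::real}) \<inter> {w. (\<forall>j<N. 0 \<le> w j) \<and> (\<Sum>j<N. w j) = 1}"
  define f where "f w = (\<Sum>i<n. (z i - (\<Sum>j<N. w j * X j i))\<^sup>2)" for w
  note co = continuous_on_subset[OF continuous_on_product_coordinates subset_UNIV]
  have "closed {w::nat \<Rightarrow> real. (\<forall>j<N. 0 \<le> w j) \<and> (\<Sum>j<N. w j) = 1}"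
    by (intro closed_Collect_conj closed_Collect_all closed_Collect_imp closed_Collect_eq
        closed_Collect_le continuous_on_const continuous_on_sum co open_Collect_const)
  then have "compact W"
    unfolding W_def by (intro compact_Int_closed compact_cube)
  moreover have "restrict (\<lambda>j. if j = 0 then 1 else 0) {..<N} \<in> W"
    using False by (auto simp: W_def)
  moreover have "continuous_on W f"
    unfolding f_def by (intro continuous_on_sum continuous_on_power continuous_on_diff
        continuous_on_mult continuous_on_const co)
  ultimately obtain w where w: "w \<in> W" "\<And>v. v \<in> W \<Longrightarrow> f w \<le> f v"
    using continuous_attains_inf[of W f] by blast
  have w0: "\<forall>j<N. 0 \<le> w j" and w1: "(\<Sum>j<N. w j) = 1" using w by (auto simp: W_def)
  define p where "p i = (\<Sum>j<N. w j * X j i)" for i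
  define \<theta> where "\<theta> i = z i - p i" for i
  have fw: "f w = (\<Sum>i<n. (\<theta> i)\<^sup>2)" by (simp add: f_def \<theta>_def p_def)
  have pos: "0 < f w"
  proof (rule ccontr)
    assume "\<not> 0 < f w"
    then have "(\<Sum>i<n. (\<theta> i)\<^sup>2) = 0" using fw sum_nonneg[of "{..<n}" "\<lambda>i. (\<theta> i)\<^sup>2"] by simp
    then have "\<theta> i = 0" if "i < n" for i using that by (subst (asm) sum_nonneg_eq_0_iff) auto
    then have "z = restrict (\<lambda>i. \<Sum>j<N. w j * X j i) {..<n}"
      using z by (intro ext) (auto simp: \<theta>_def p_def Rn_eq restrict_def)
    then show False using nz w0 w1 by (auto simp: conv_pts_def)
  qed
  have "(\<Sum>i<n. \<theta> i * X j i) < (\<Sum>i<n. \<theta> i * z i)" if j: "j < N" for j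
  proof -
    define e where "e = (\<Sum>i<n. \<theta> i * (X j i - p i))"
    define q where "q = (\<Sum>i<n. (X j i - p i)\<^sup>2)"
    have q0: "0 \<le> q" by (simp add: q_def sum_nonneg)
    have "e \<le> 0"
    proof (rule ccontr)
      assume "\<not> e \<le> 0"
      then have e: "0 < e" by simp
      \<comment> \<open>Moving the weights by \<open>h\<close> towards vertex \<open>j\<close>
        changes the squared distance by \<open>- 2 h e + h^2 q\<close>, negative for so short a
        step; \<open>q + 1\<close> guards against \<open>q = 0\<close>.\<close>
      define h where "h = min 1 (e / (q + 1))"
      have h: "0 < h" "h \<le> 1" using e q0 by (auto simp: h_def)
      have "h \<le> e / (q + 1)" by (simp add: h_def)
      then have hq: "h * (q + 1) \<le> e" using q0 by (simp add: pos_le_divide_eq)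
      define v where "v = restrict (\<lambda>k. (1 - h) * w k + h * (if k = j then 1 else 0)) {..<N}"
      have v0: "\<forall>k<N. 0 \<le> v k" using w0 h by (auto simp: v_def)
      have v1: "(\<Sum>k<N. v k) = 1"
      proof -
        have "(\<Sum>k<N. v k) = (1 - h) * (\<Sum>k<N. w k) + h * (\<Sum>k<N. if k = j then 1 else 0)"
          unfolding sum_distrib_left sum.distrib[symmetric] by (intro sum.cong) (auto simp: v_def)
        then show ?thesis using w1 j by simp
      qed
      have "v k \<le> 1" if "k < N" for k
        using v1 v0 that member_le_sum[of k "{..<N}" v] by auto
      moreover have "- 1 \<le> v k" if "k < N" for k using v0 that by (smt (verit))
      ultimately have "v \<in> PiE {..<N} (\<lambda>_. {- 1..1})"
        by (intro PiE_I) (auto simp: v_def)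
      then have vW: "v \<in> W" using v0 v1 by (auto simp: W_def)
      have vX: "(\<Sum>k<N. v k * X k i) = p i + h * (X j i - p i)" for i
      proof -
        have "(\<Sum>k<N. v k * X k i) =
            (1 - h) * (\<Sum>k<N. w k * X k i) + h * (\<Sum>k<N. if k = j then X k i else 0)"
          unfolding sum_distrib_left sum.distrib[symmetric]
          by (intro sum.cong) (auto simp: v_def algebra_simps)
        then show ?thesis using j by (simp add: p_def algebra_simps)
      qed
      have "f v = (\<Sum>i<n. (\<theta> i)\<^sup>2 - 2 * h * (\<theta> i * (X j i - p i)) + h\<^sup>2 * (X j i - p i)\<^sup>2)"
        unfolding f_def vX by (intro sum.cong) (auto simp: \<theta>_def power2_eq_square algebra_simps)
      also have "\<dots> = f w - 2 * h * e + h\<^sup>2 * q"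
        unfolding e_def q_def fw sum_distrib_left by (simp add: sum.distrib sum_subtractf)
      finally have "2 * h * e \<le> h\<^sup>2 * q" using w(2)[OF vW] by simp
      then have "2 * e \<le> h * q" using h by (simp add: power2_eq_square mult.assoc mult.left_commute)
      then show False using hq e h q0 by (simp add: algebra_simps)
    qed
    then have "(\<Sum>i<n. \<theta> i * X j i) \<le> (\<Sum>i<n. \<theta> i * p i)"
      by (simp add: e_def right_diff_distrib sum_subtractf)
    also have "\<dots> = (\<Sum>i<n. \<theta> i * z i) - f w"
      by (simp add: fw sum_subtractf[symmetric] \<theta>_def power2_eq_square algebra_simps)
    finally show ?thesis using pos by simp
  qed
  then show ?thesis by blast
qed auto

text \<open>Strict separation from finitely many points survives a small perturbation of the normal.
  Rational normals leave countably many conditions, on which measurability of the hull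
  rests.\<close>

lemma conv_pts_separation_Rats:
  assumes z: "z \<in> Rn n" and nz: "z \<notin> conv_pts n N X"
  shows "\<exists>\<theta>\<in>PiE {..<n} (\<lambda>_. \<rat>). \<forall>j<N. (\<Sum>i<n. \<theta> i * X j i) < (\<Sum>i<n. \<theta> i * z i)"
proof -
  obtain \<theta> where \<theta>: "\<forall>j<N. (\<Sum>i<n. \<theta> i * X j i) < (\<Sum>i<n. \<theta> i * z i)"
    using conv_pts_separation[OF assms] by blast
  \<comment> \<open>Inserting 1 keeps the set nonempty when \<open>N = 0\<close>.\<close>
  define g where "g = Min (insert 1 ((\<lambda>j. \<Sum>i<n. \<theta> i * (z i - X j i)) ` {..<N}))"
  have g0: "0 < g" unfolding g_def using \<theta>
    by (subst Min_gr_iff) (auto simp: right_diff_distrib sum_subtractf)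
  have gj: "g \<le> (\<Sum>i<n. \<theta> i * (z i - X j i))" if "j < N" for j
    unfolding g_def using that by (intro Min_le) auto
  define B where "B = 1 + (\<Sum>j<N. \<Sum>i<n. \<bar>z i - X j i\<bar>)"
  have B0: "1 \<le> B" by (simp add: B_def sum_nonneg)
  define \<epsilon> where "\<epsilon> = g / (2 * B)"
  have \<epsilon>0: "0 < \<epsilon>" using g0 B0 by (simp add: \<epsilon>_def)
  have "\<exists>r\<in>\<rat>. \<bar>r - \<theta> i\<bar> \<le> \<epsilon>" for i
    using Rats_dense_in_real[of "\<theta> i" "\<theta> i + \<epsilon>"] \<epsilon>0 by (auto intro!: bexI)
  then obtain r where r: "\<And>i. r i \<in> \<rat>" "\<And>i. \<bar>r i - \<theta> i\<bar> \<le> \<epsilon>" by metis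
  have "(\<Sum>i<n. r i * X j i) < (\<Sum>i<n. r i * z i)" if j: "j < N" for j
  proof -
    have "(\<Sum>i<n. \<theta> i * (z i - X j i)) - (\<Sum>i<n. r i * (z i - X j i))
        = (\<Sum>i<n. (\<theta> i - r i) * (z i - X j i))"
      by (simp add: sum_subtractf[symmetric] algebra_simps)
    also have "\<dots> \<le> (\<Sum>i<n. \<epsilon> * \<bar>z i - X j i\<bar>)"
    proof (rule sum_mono)
      fix i
      have "(\<theta> i - r i) * (z i - X j i) \<le> \<bar>\<theta> i - r i\<bar> * \<bar>z i - X j i\<bar>"
        by (metis abs_ge_self abs_mult)
      also have "\<dots> \<le> \<epsilon> * \<bar>z i - X j i\<bar>"
        using r(2)[of i] by (intro mult_right_mono) (auto simp: abs_minus_commute)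
      finally show "(\<theta> i - r i) * (z i - X j i) \<le> \<epsilon> * \<bar>z i - X j i\<bar>" .
    qed
    also have "\<dots> = \<epsilon> * (\<Sum>i<n. \<bar>z i - X j i\<bar>)" by (simp add: sum_distrib_left)
    also have "\<dots> \<le> \<epsilon> * B"
    proof -
      have "(\<Sum>i<n. \<bar>z i - X j i\<bar>) \<le> (\<Sum>j<N. \<Sum>i<n. \<bar>z i - X j i\<bar>)"
        using j by (intro member_le_sum) (auto simp: sum_nonneg)
      then show ?thesis using \<epsilon>0 by (intro mult_left_mono) (auto simp: B_def)
    qed
    also have "\<dots> = g / 2" using B0 by (simp add: \<epsilon>_def)
    finally have "0 < (\<Sum>i<n. r i * (z i - X j i))" using gj[OF j] g0 by linarith
    then show ?thesis by (simp add: right_diff_distrib sum_subtractf)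
  qed
  then show ?thesis
    using r(1) by (intro bexI[of _ "restrict r {..<n}"]) auto
qed

lemma conv_pts_le:
  assumes "z \<in> conv_pts n N X"
  shows "\<exists>j<N. (\<Sum>i<n. \<theta> i * z i) \<le> (\<Sum>i<n. \<theta> i * X j i)"
proof (rule ccontr)
  assume "\<not> ?thesis"
  then have lt: "\<And>j. j < N \<Longrightarrow> (\<Sum>i<n. \<theta> i * X j i) < (\<Sum>i<n. \<theta> i * z i)" by force
  obtain w where w: "\<forall>j<N. 0 \<le> w j" "(\<Sum>j<N. w j) = 1"
    and z: "z = restrict (\<lambda>i. \<Sum>j<N. w j * X j i) {..<n}"
    using assms by (auto simp: conv_pts_def)
  obtain k where k: "k < N" "0 < w k"
    using w by (metis less_eq_real_def lessThan_iff sum.neutral zero_neq_one)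
  have "(\<Sum>i<n. \<theta> i * z i) = (\<Sum>i<n. \<Sum>j<N. w j * (\<theta> i * X j i))"
    by (simp add: z sum_distrib_left algebra_simps)
  also have "\<dots> = (\<Sum>j<N. w j * (\<Sum>i<n. \<theta> i * X j i))"
    by (subst sum.swap) (simp add: sum_distrib_left)
  also have "\<dots> < (\<Sum>j<N. w j * (\<Sum>i<n. \<theta> i * z i))"
  proof (rule sum_strict_mono_ex1)
    show "\<forall>j\<in>{..<N}. w j * (\<Sum>i<n. \<theta> i * X j i) \<le> w j * (\<Sum>i<n. \<theta> i * z i)"
      using lt w by (auto intro!: mult_left_mono intro: less_imp_le)
    show "\<exists>j\<in>{..<N}. w j * (\<Sum>i<n. \<theta> i * X j i) < w j * (\<Sum>i<n. \<theta> i * z i)"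
      using k lt[of k] by (intro bexI[of _ k] mult_strict_left_mono) auto
  qed simp
  also have "\<dots> = (\<Sum>i<n. \<theta> i * z i)" using w by (simp flip: sum_distrib_right)
  finally show False by simp
qed

lemma conv_pts_subset_Rn: "conv_pts n N X \<subseteq> Rn n"
  by (auto simp: conv_pts_def Rn_eq)

text \<open>Turns membership into a countable intersection of finite unions of conditions that are
  measurable jointly in \<open>z\<close> and the points.\<close>

lemma conv_pts_iff:
  assumes "z \<in> Rn n"
  shows "z \<in> conv_pts n N X \<longleftrightarrow>
    (\<forall>\<theta>\<in>PiE {..<n} (\<lambda>_. \<rat>). \<exists>j\<in>{..<N}. (\<Sum>i<n. \<theta> i * z i) \<le> (\<Sum>i<n. \<theta> i * X j i))"
  using conv_pts_separation_Rats[OF assms, of N X] conv_pts_le[of z n N X]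
  by (metis lessThan_iff not_le)

section \<open>Measurability of the hull and the hitting bound\<close>

context log_concave_space
begin

lemma measurable_coord: "i < n \<Longrightarrow> (\<lambda>x. x i) \<in> borel_measurable M"
  using measurable_component_singleton[of i "{..<n}" "\<lambda>_. borel"]
  by (simp add: measurable_cong_sets[OF sets_M refl])

text \<open>One measurable set \<open>D\<close> in the product of the sample space with
  \<open>M\<close> gives both claims: its sections are the hulls, and measures of sections depend
  measurably on the sample.\<close>

lemma conv_pts_measurable:
  shows "(\<lambda>X. prob (conv_pts n N X)) \<in> borel_measurable (PiM {..<N} (\<lambda>_. M))"
    and "X \<in> space (PiM {..<N} (\<lambda>_. M)) \<Longrightarrow> conv_pts n N X \<in> events"
proof -
  let ?P = "PiM {..<N} (\<lambda>_. M)"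
  let ?\<Theta> = "PiE {..<n} (\<lambda>_. \<rat>) :: (nat \<Rightarrow> real) set"
  define D where "D = {p \<in> space (?P \<Otimes>\<^sub>M M). snd p \<in> conv_pts n N (fst p)}"
  have c: "countable ?\<Theta>" by (intro countable_PiE) (auto simp: countable_rat)
  have m: "(\<lambda>p. snd p i) \<in> borel_measurable (?P \<Otimes>\<^sub>M M)" if "i < n" for i
    by (rule measurable_compose[OF measurable_snd measurable_coord[OF that]])
  have m': "(\<lambda>p. fst p j i) \<in> borel_measurable (?P \<Otimes>\<^sub>M M)" if "i < n" "j < N" for i j
  proof -
    have "(\<lambda>p. fst p j) \<in> ?P \<Otimes>\<^sub>M M \<rightarrow>\<^sub>M M"
      using that by (intro measurable_compose[OF measurable_fst measurable_component_singleton]) simp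
    then show ?thesis by (rule measurable_compose[OF _ measurable_coord[OF that(1)]])
  qed
  have "D = {p \<in> space (?P \<Otimes>\<^sub>M M). \<forall>\<theta>\<in>?\<Theta>. \<exists>j\<in>{..<N}.
      (\<Sum>i<n. \<theta> i * snd p i) \<le> (\<Sum>i<n. \<theta> i * fst p j i)}"
    unfolding D_def by (intro Collect_cong conj_cong refl conv_pts_iff)
      (auto simp: space_pair_measure space_M)
  also have "\<dots> \<in> sets (?P \<Otimes>\<^sub>M M)"
    using c m m'
    by (intro sets.sets_Collect_countable_All' sets.sets_Collect_finite_Ex borel_measurable_le
        borel_measurable_sum borel_measurable_times borel_measurable_const) auto
  finally have D: "D \<in> sets (?P \<Otimes>\<^sub>M M)" .
  have eq: "Pair X -` D = conv_pts n N X" if "X \<in> space ?P" for X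
    using that conv_pts_subset_Rn[of n N X] by (auto simp: D_def space_pair_measure space_M)
  show "(\<lambda>X. prob (conv_pts n N X)) \<in> borel_measurable ?P"
  proof -
    have "(\<lambda>X. enn2real (emeasure M (Pair X -` D))) \<in> borel_measurable ?P"
      using measurable_emeasure_Pair[OF D] by measurable
    then show ?thesis
      by (rule measurable_cong[THEN iffD1, rotated]) (simp add: eq measure_def)
  qed
  show "conv_pts n N X \<in> events" if "X \<in> space ?P"
    using sets_Pair1[OF D, of X] eq[OF that] by simp
qed

text \<open>Union bound: all \<open>N\<close> points miss a given \<open>T\<close> with probability
  at most \<open>(1 - \<eta>)^N\<close>, and off these events the hull contains the fixed set
  \<open>Z\<close>.\<close>

lemma expected_hull_measure_ge:
  assumes fin: "finite \<T>" and T: "\<And>T. T \<in> \<T> \<Longrightarrow> T \<in> events \<and> \<eta> \<le> prob T"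
    and \<eta>: "0 \<le> \<eta>" "\<eta> \<le> 1" and Z: "Z \<in> events"
    and hit: "\<And>X. (\<And>j. j < N \<Longrightarrow> X j \<in> Rn n) \<Longrightarrow> (\<And>T. T \<in> \<T> \<Longrightarrow> \<exists>j<N. X j \<in> T) \<Longrightarrow> Z \<subseteq> conv_pts n N X"
  shows "(1 - real (card \<T>) * (1 - \<eta>) ^ N) * prob Z \<le> expected_hull_measure n M N"
proof -
  let ?P = "PiM {..<N} (\<lambda>_. M)"
  interpret P: product_prob_space "\<lambda>_. M" "{..<N}" by unfold_locales
  define F where "F T = PiE {..<N} (\<lambda>_. space M - T)" for T
  have Fm: "F T \<in> sets ?P" if "T \<in> \<T>" for T
    unfolding F_def using T[OF that] by (intro sets_PiM_I_finite) auto
  have Fp: "measure ?P (F T) \<le> (1 - \<eta>) ^ N" if "T \<in> \<T>" for T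
  proof -
    have "emeasure ?P (F T) = (\<Prod>j<N. emeasure M (space M - T))"
      unfolding F_def using T[OF that] by (intro P.emeasure_PiM) auto
    also have "\<dots> = ennreal ((1 - prob T) ^ N)"
      using T[OF that] by (simp add: emeasure_eq_measure prob_compl ennreal_power)
    finally have "measure ?P (F T) = (1 - prob T) ^ N"
      by (simp add: measure_eq_emeasure_eq_ennreal)
    also have "\<dots> \<le> (1 - \<eta>) ^ N" using T[OF that] by (intro power_mono) auto
    finally show ?thesis .
  qed
  define E where "E = space ?P - (\<Union>T\<in>\<T>. F T)"
  have Em: "E \<in> sets ?P" unfolding E_def using Fm fin by auto
  have "measure ?P (\<Union>T\<in>\<T>. F T) \<le> (\<Sum>T\<in>\<T>. measure ?P (F T))"
    using fin Fm by (intro measure_UNION_le) auto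
  also have "\<dots> \<le> (\<Sum>T\<in>\<T>. (1 - \<eta>) ^ N)" using Fp by (intro sum_mono)
  finally have "measure ?P (\<Union>T\<in>\<T>. F T) \<le> real (card \<T>) * (1 - \<eta>) ^ N" by simp
  moreover have "measure ?P E = 1 - measure ?P (\<Union>T\<in>\<T>. F T)"
    unfolding E_def using fin Fm by (intro P.P.prob_compl) auto
  ultimately have pE: "1 - real (card \<T>) * (1 - \<eta>) ^ N \<le> measure ?P E" by simp
  have sub: "Z \<subseteq> conv_pts n N X" if X: "X \<in> E" for X
  proof (rule hit)
    show Xs: "X j \<in> Rn n" if "j < N" for j
      using X that by (auto simp: E_def space_PiM space_M)
    show "\<exists>j<N. X j \<in> T" if "T \<in> \<T>" for T
    proof (rule ccontr)
      assume "\<not> ?thesis"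
      then have "X \<in> F T" using X Xs
        by (auto simp: F_def E_def space_PiM PiE_iff space_M)
      then show False using X that by (auto simp: E_def)
    qed
  qed
  have "(1 - real (card \<T>) * (1 - \<eta>) ^ N) * prob Z \<le> measure ?P E * prob Z"
    using pE by (intro mult_right_mono) auto
  also have "\<dots> = (\<integral>X. prob Z * indicator E X \<partial>?P)"
    using Em sets.sets_into_space[OF Em] by (simp add: Int_absorb2 Int_absorb1 Int_commute)
  also have "\<dots> \<le> (\<integral>X. prob (conv_pts n N X) \<partial>?P)"
  proof (rule integral_mono)
    show "integrable ?P (\<lambda>X. prob Z * indicator E X)"
      using Em by (intro integrable_mult_right integrable_real_indicator) (auto simp: P.P.emeasure_eq_measure)
    show "integrable ?P (\<lambda>X. prob (conv_pts n N X))"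
      by (intro P.P.integrable_const_bound[where B = 1] conv_pts_measurable) auto
    show "prob Z * indicator E X \<le> prob (conv_pts n N X)" if "X \<in> space ?P" for X
      using sub conv_pts_measurable(2)[OF that] Z
      by (auto simp: indicator_def intro!: finite_measure_mono)
  qed
  finally show ?thesis by (simp add: expected_hull_measure_def)
qed

end

section \<open>Orthonormal affine forms\<close>

lemma affine_form_sum:
  "(\<Sum>k\<in>K. t k * affine_form n (a k) (b k) x) =
     affine_form n (\<lambda>i. \<Sum>k\<in>K. t k * a k i) (\<Sum>k\<in>K. t k * b k) x"
  unfolding affine_form_def distrib_left sum.distrib sum_distrib_left sum_distrib_right
  by (subst sum.swap) (simp add: mult.assoc)

lemma affine_form_scale: "affine_form n (\<lambda>i. a i / c) (b / c) x = affine_form n a b x / c"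
  by (simp add: affine_form_def sum_divide_distrib add_divide_distrib)

lemma affine_form_coord:
  "k < n \<Longrightarrow> affine_form n (\<lambda>i. if i = k then 1 else 0) b x = x k + b"
proof -
  assume "k < n"
  have "(\<Sum>i<n. (if i = k then 1 else 0) * x i) = (\<Sum>i<n. if i = k then x i else 0)"
    by (intro sum.cong) auto
  then show ?thesis using \<open>k < n\<close> by (simp add: affine_form_def)
qed

context log_concave_space
begin

text \<open>Orthonormalises \<open>1, x 0, ..., x (k - 1)\<close> in \<open>L^2\<close>. The
  vanishing of \<open>a j i\<close> for \<open>i >= k\<close> makes the system triangular, so the
  next form has coefficient 1 at \<open>x k\<close> before scaling. The last clause inverts the
  system at every point, not just almost everywhere, as it will be evaluated at sample
  points.\<close>

lemma gram_schmidt: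
  assumes "k \<le> n"
  shows "\<exists>a b. (\<forall>j<k. expectation (affine_form n (a j) (b j)) = 0) \<and>
    (\<forall>i<k. \<forall>j<k. expectation (\<lambda>w. affine_form n (a i) (b i) w * affine_form n (a j) (b j) w)
       = (if i = j then 1 else 0)) \<and>
    (\<forall>j<k. \<forall>i\<ge>k. a j i = 0) \<and>
    (\<forall>i<k. \<exists>t c. \<forall>x. x i = c + (\<Sum>j<k. t j * affine_form n (a j) (b j) x))"
  using assms
proof (induction k)
  case 0
  then show ?case by simp
next
  case (Suc k)
  obtain a b where H: "\<forall>j<k. expectation (affine_form n (a j) (b j)) = 0"
    "\<forall>i<k. \<forall>j<k. expectation (\<lambda>w. affine_form n (a i) (b i) w * affine_form n (a j) (b j) w)
       = (if i = j then 1 else 0)"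
    "\<forall>j<k. \<forall>i\<ge>k. a j i = 0"
    "\<forall>i<k. \<exists>t c. \<forall>x. x i = c + (\<Sum>j<k. t j * affine_form n (a j) (b j) x)"
    using Suc.IH[OF Suc_leD[OF Suc.prems]] by (elim exE conjE)
  note c0 = H(1)[rule_format] and on = H(2)[rule_format] and z = H(3)[rule_format] and sp = H(4)[rule_format]
  have kn: "k < n" using Suc.prems by simp
  define \<phi> where "\<phi> j = affine_form n (a j) (b j)" for j
  define e where "e = affine_form n (\<lambda>i. if i = k then 1 else 0) 0"
  have ek: "e x = x k" for x using affine_form_coord[OF kn] by (simp add: e_def)
  define m where "m = expectation e"
  define c where "c j = expectation (\<lambda>w. e w * \<phi> j w)" for j
  define \<alpha> where "\<alpha> i = (if i = k then 1 else 0) - (\<Sum>j<k. c j * a j i)" for i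
  define \<beta> where "\<beta> = - m - (\<Sum>j<k. c j * b j)"
  define \<psi> where "\<psi> = affine_form n \<alpha> \<beta>"
  have \<psi>: "\<psi> x = e x - m - (\<Sum>j<k. c j * \<phi> j x)" for x
    unfolding \<phi>_def affine_form_sum
    by (simp add: \<psi>_def e_def affine_form_def \<alpha>_def \<beta>_def left_diff_distrib sum_subtractf)
  have i1: "integrable M e" "\<And>j. integrable M (\<phi> j)" "integrable M \<psi>" by (auto simp: e_def \<phi>_def \<psi>_def)
  have i2: "\<And>j. integrable M (\<lambda>w. e w * \<phi> j w)" "\<And>i j. integrable M (\<lambda>w. \<phi> i w * \<phi> j w)"
    "integrable M (\<lambda>w. \<psi> w * \<psi> w)" by (auto simp: e_def \<phi>_def \<psi>_def)
  have E\<psi>: "expectation \<psi> = 0"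
  proof -
    have "expectation \<psi> = expectation (\<lambda>x. e x - m - (\<Sum>j<k. c j * \<phi> j x))"
      by (intro Bochner_Integration.integral_cong) (auto simp: \<psi>)
    also have "\<dots> = expectation e - m - (\<Sum>j<k. c j * expectation (\<phi> j))"
      using i1 by (simp add: prob_space)
    also have "(\<Sum>j<k. c j * expectation (\<phi> j)) = 0"
      using c0 by (intro sum.neutral) (auto simp: \<phi>_def)
    finally show ?thesis by (simp add: m_def)
  qed
  have E\<psi>\<phi>: "expectation (\<lambda>w. \<psi> w * \<phi> j w) = 0" if j: "j < k" for j
  proof -
    have "expectation (\<lambda>w. \<psi> w * \<phi> j w)
        = expectation (\<lambda>w. e w * \<phi> j w - m * \<phi> j w - (\<Sum>l<k. c l * (\<phi> l w * \<phi> j w)))"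
      by (intro Bochner_Integration.integral_cong)
        (auto simp: \<psi> left_diff_distrib sum_distrib_right mult.assoc)
    also have "\<dots> = c j - m * expectation (\<phi> j) - (\<Sum>l<k. c l * expectation (\<lambda>w. \<phi> l w * \<phi> j w))"
      using i1 i2 by (simp add: c_def)
    also have "(\<Sum>l<k. c l * expectation (\<lambda>w. \<phi> l w * \<phi> j w)) = (\<Sum>l<k. if l = j then c l else 0)"
      using on j by (intro sum.cong) (auto simp: \<phi>_def)
    finally show ?thesis using c0[OF j] j by (simp add: \<phi>_def)
  qed
  define V where "V = expectation (\<lambda>w. \<psi> w * \<psi> w)"
  \<comment> \<open>\<open>V = 0\<close> would put full measure on the hyperplane
    \<open>\<psi> = 0\<close>, whose normal has entry 1 at \<open>k\<close>. This is where
    nondegeneracy of the measure enters.\<close>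
  have V: "0 < V"
  proof (rule ccontr)
    assume "\<not> 0 < V"
    moreover have "0 \<le> V" unfolding V_def by (intro Bochner_Integration.integral_nonneg) auto
    ultimately have "V = 0" by simp
    then have "AE w in M. \<psi> w * \<psi> w = 0"
      using integral_nonneg_eq_0_iff_AE[OF i2(3)] by (simp add: V_def)
    moreover have "{w \<in> space M. \<psi> w * \<psi> w = 0} = hyperplane n \<alpha> (- \<beta>)"
      by (auto simp: hyperplane_def \<psi>_def affine_form_def space_M)
    moreover have "{w \<in> space M. \<psi> w * \<psi> w = 0} \<in> events" unfolding \<psi>_def by measurable
    ultimately have "prob (hyperplane n \<alpha> (- \<beta>)) = 1"
      using prob_Collect_eq_1[of "\<lambda>w. \<psi> w * \<psi> w = 0"] by simp
    moreover have "\<alpha> k \<noteq> 0" using z by (simp add: \<alpha>_def)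
    ultimately show False using hyperplane_lt[OF kn, of \<alpha> "- \<beta>"] by simp
  qed
  define a' where "a' = a(k := \<lambda>i. \<alpha> i / sqrt V)"
  define b' where "b' = b(k := \<beta> / sqrt V)"
  have old: "affine_form n (a' j) (b' j) = \<phi> j" if "j < k" for j
    using that by (simp add: a'_def b'_def \<phi>_def)
  have new: "affine_form n (a' k) (b' k) = (\<lambda>w. \<psi> w / sqrt V)"
    by (intro ext) (simp add: a'_def b'_def \<psi>_def affine_form_scale)
  have new2: "expectation (\<lambda>w. \<psi> w / sqrt V * (\<psi> w / sqrt V)) = 1"
    using V by (simp add: V_def[symmetric])
  show ?case
  proof (rule exI[of _ a'], rule exI[of _ b'], intro conjI allI impI)
    show "expectation (affine_form n (a' j) (b' j)) = 0" if "j < Suc k" for j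
      using that c0[of j] E\<psi> by (cases "j = k") (auto simp: new old \<phi>_def)
    show "expectation (\<lambda>w. affine_form n (a' i) (b' i) w * affine_form n (a' j) (b' j) w)
        = (if i = j then 1 else 0)" if "i < Suc k" "j < Suc k" for i j
      using that on[of i j] E\<psi>\<phi>[of i] E\<psi>\<phi>[of j] new2
      by (cases "i = k"; cases "j = k") (auto simp: new old \<phi>_def mult.commute)
    show "a' j i = 0" if "j < Suc k" "Suc k \<le> i" for i j
      using that z[of j i] z by (auto simp: a'_def \<alpha>_def)
    show "\<exists>t c. \<forall>x. x i = c + (\<Sum>j<Suc k. t j * affine_form n (a' j) (b' j) x)" if "i < Suc k" for i
    proof (cases "i = k")
      case True
      have "x k = m + (\<Sum>j<Suc k. (c(k := sqrt V)) j * affine_form n (a' j) (b' j) x)" for x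
        using V by (simp add: new old \<psi> ek)
      then show ?thesis using True by blast
    next
      case False
      then obtain t d where "\<forall>x. x i = d + (\<Sum>j<k. t j * \<phi> j x)"
        using sp[of i] \<open>i < Suc k\<close> by (auto simp: \<phi>_def)
      then have "\<forall>x. x i = d + (\<Sum>j<Suc k. (t(k := 0)) j * affine_form n (a' j) (b' j) x)"
        by (simp add: old)
      then show ?thesis by blast
    qed
  qed
qed

text \<open>The forms act as a whitening map: up to a constant, every linear functional is a
  combination of uncorrelated coordinates of unit variance.\<close>

lemma exists_orthonormal_forms:
  "\<exists>a b. (\<forall>j<n. expectation (affine_form n (a j) (b j)) = 0) \<and>
    (\<forall>i<n. \<forall>j<n. expectation (\<lambda>w. affine_form n (a i) (b i) w * affine_form n (a j) (b j) w)
       = (if i = j then 1 else 0)) \<and>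
    (\<forall>\<theta>. \<exists>t c. \<forall>x. (\<Sum>i<n. \<theta> i * x i) = c + (\<Sum>j<n. t j * affine_form n (a j) (b j) x))"
proof -
  obtain a b where
    *: "\<forall>j<n. expectation (affine_form n (a j) (b j)) = 0"
    "\<forall>i<n. \<forall>j<n. expectation (\<lambda>w. affine_form n (a i) (b i) w * affine_form n (a j) (b j) w)
       = (if i = j then 1 else 0)" and
    sp: "\<forall>i<n. \<exists>t c. \<forall>x. x i = c + (\<Sum>j<n. t j * affine_form n (a j) (b j) x)"
    using gram_schmidt[OF order_refl] by (elim exE conjE)
  obtain t c where tc: "\<And>i x. i < n \<Longrightarrow> x i = c i + (\<Sum>j<n. t i j * affine_form n (a j) (b j) x)"
    using sp by metis
  have "(\<Sum>i<n. \<theta> i * x i) =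
    (\<Sum>i<n. \<theta> i * c i) + (\<Sum>j<n. (\<Sum>i<n. \<theta> i * t i j) * affine_form n (a j) (b j) x)" for \<theta> x
  proof -
    have "(\<Sum>i<n. \<theta> i * x i) = (\<Sum>i<n. \<theta> i * (c i + (\<Sum>j<n. t i j * affine_form n (a j) (b j) x)))"
      using tc by (intro sum.cong) auto
    also have "\<dots> = (\<Sum>i<n. \<theta> i * c i) + (\<Sum>i<n. \<Sum>j<n. \<theta> i * t i j * affine_form n (a j) (b j) x)"
      by (simp add: distrib_left sum.distrib sum_distrib_left mult.assoc)
    also have "(\<Sum>i<n. \<Sum>j<n. \<theta> i * t i j * affine_form n (a j) (b j) x)
      = (\<Sum>j<n. (\<Sum>i<n. \<theta> i * t i j) * affine_form n (a j) (b j) x)"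
      by (subst sum.swap) (simp add: sum_distrib_right)
    finally show ?thesis .
  qed
  then have "\<forall>\<theta>. \<exists>t c. \<forall>x. (\<Sum>i<n. \<theta> i * x i) = c + (\<Sum>j<n. t j * affine_form n (a j) (b j) x)"
    by (intro allI exI[of _ "\<lambda>j. \<Sum>i<n. \<theta> i * t i j" for \<theta>] exI[of _ "\<Sum>i<n. \<theta> i * c i" for \<theta>])
  then show ?thesis using * by (intro exI[of _ a] exI[of _ b] conjI)
qed

end

section \<open>Heavy cells of a grid\<close>

text \<open>Roles: \<open>s\<close> is the level that every centred unit-variance form reaches with
  probability \<open>s^2\<close>, \<open>\<kappa>\<close> the discarded measure,
  \<open>\<tau>\<close> the contraction, \<open>r\<close> the cell side, \<open>L\<close> the tail
  cutoff, \<open>2 J\<close> the number of cells per axis, \<open>\<eta>\<close> the threshold for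
  keeping a cell. The constants 8 and 12 split an error budget of \<open>\<tau> s / 2\<close>
  equally between \<open>sqrt \<kappa>\<close> and \<open>r\<close>; the two bounds
  \<open>\<kappa> / 2\<close> pay for the tails and for the light cells.\<close>

locale grid = log_concave_space M n for M :: "(nat \<Rightarrow> real) measure" and n :: nat +
  fixes a :: "nat \<Rightarrow> nat \<Rightarrow> real" and b :: "nat \<Rightarrow> real"
    and s \<kappa> \<tau> r L \<eta> :: real and J :: nat
  assumes n0: "0 < n"
    and centred: "\<And>j. j < n \<Longrightarrow> expectation (affine_form n (a j) (b j)) = 0"
    and orthonormal: "\<And>i j. i < n \<Longrightarrow> j < n \<Longrightarrow>
      expectation (\<lambda>w. affine_form n (a i) (b i) w * affine_form n (a j) (b j) w) = (if i = j then 1 else 0)"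
    and spanning: "\<And>\<theta>. \<exists>t c. \<forall>x. (\<Sum>i<n. \<theta> i * x i) = c + (\<Sum>j<n. t j * affine_form n (a j) (b j) x)"
    and one_sided: "\<And>\<alpha> \<beta>. expectation (affine_form n \<alpha> \<beta>) = 0 \<Longrightarrow>
      expectation (\<lambda>w. (affine_form n \<alpha> \<beta> w)\<^sup>2) = 1 \<Longrightarrow> s\<^sup>2 \<le> prob {w \<in> space M. s \<le> affine_form n \<alpha> \<beta> w}"
    and s: "0 < s" "s \<le> 1"
    and \<kappa>: "0 < \<kappa>" "sqrt \<kappa> \<le> s / (8 * real n)"
    and \<tau>: "0 < \<tau>" "\<tau> < 1"
    and r: "r = \<tau> * s / (12 * real n)"
    and L: "0 < L" "L \<le> real J * r" "real n / L\<^sup>2 \<le> \<kappa> / 2"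
    and \<eta>: "0 < \<eta>" "real (2 * J) ^ n * \<eta> \<le> \<kappa> / 2"
begin

definition \<phi> :: "nat \<Rightarrow> (nat \<Rightarrow> real) \<Rightarrow> real" where
  "\<phi> k = affine_form n (a k) (b k)"

text \<open>The corner \<open>l\<close> is an arbitrary real vector, since averages of grid corners
  leave the grid.\<close>

definition box :: "(nat \<Rightarrow> real) \<Rightarrow> (nat \<Rightarrow> real) set" where
  "box l = {x \<in> space M. \<forall>k<n. l k \<le> \<phi> k x \<and> \<phi> k x \<le> l k + r}"

lemma \<phi>_measurable [measurable]: "\<phi> k \<in> borel_measurable M"
  by (simp add: \<phi>_def)

lemma r0: "0 < r" using r \<tau> s n0 by simp

lemma \<kappa>_bounds: "\<kappa> < s\<^sup>2" "\<kappa> \<le> 1/4"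
proof -
  have "s / (8 * real n) \<le> s / 8" using n0 s by (intro divide_left_mono) auto
  then have "sqrt \<kappa> \<le> s / 8" using \<kappa> by simp
  then have "(sqrt \<kappa>)\<^sup>2 \<le> (s / 8)\<^sup>2" using \<kappa> by (intro power_mono) auto
  then have k: "\<kappa> \<le> s\<^sup>2 / 64" using \<kappa> by (simp add: power_divide)
  have "0 < s\<^sup>2" "s\<^sup>2 \<le> 1" using s by (auto simp: power_le_one)
  then show "\<kappa> < s\<^sup>2" "\<kappa> \<le> 1/4" using k by linarith+
qed

lemma closed_box: "closed (box l)"
proof -
  have "box l = Rn n \<inter> {x. \<forall>k<n. l k \<le> \<phi> k x \<and> \<phi> k x \<le> l k + r}"
    by (auto simp: box_def space_M)
  moreover have "closed {x. \<forall>k<n. l k \<le> \<phi> k x \<and> \<phi> k x \<le> l k + r}"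
    unfolding \<phi>_def
    by (intro closed_Collect_all closed_Collect_imp closed_Collect_conj closed_Collect_le
        open_Collect_const continuous_on_const continuous_on_affine_form)
  ultimately show ?thesis using closed_Rn by auto
qed

lemma box_events [measurable]: "box l \<in> events"
  unfolding box_def by measurable

lemma box_comb:
  assumes "x \<in> box l" "y \<in> box l'" "0 < t" "t < 1"
  shows "restrict (\<lambda>i. t * x i + (1 - t) * y i) {..<n} \<in> box (\<lambda>k. t * l k + (1 - t) * l' k)"
proof -
  have "t * l k + (1 - t) * l' k \<le> t * \<phi> k x + (1 - t) * \<phi> k y"
    "t * \<phi> k x + (1 - t) * \<phi> k y \<le> t * (l k + r) + (1 - t) * (l' k + r)" if "k < n" for k
    using assms that by (auto simp: box_def intro!: add_mono mult_left_mono)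
  moreover have "t * (l k + r) + (1 - t) * (l' k + r) = t * l k + (1 - t) * l' k + r" for k
    by (simp add: algebra_simps)
  ultimately show ?thesis
    unfolding box_def \<phi>_def mem_Collect_eq affine_form_comb by (auto simp: space_M Rn_def)
qed

text \<open>Averages of points of two boxes of side \<open>r\<close> lie in the box at the averaged
  corner, again of side \<open>r\<close>, and \<open>\<eta>\<close> is its own weighted geometric
  mean. Endpoints are separate because log-concavity is assumed for
  \<open>0 < t < 1\<close>.\<close>

lemma box_superlevel_comb:
  assumes "\<eta> \<le> prob (box l)" "\<eta> \<le> prob (box l')" "0 \<le> t" "t \<le> 1"
  shows "\<eta> \<le> prob (box (\<lambda>k. t * l k + (1 - t) * l' k))"
proof (cases "t = 0 \<or> t = 1")
  case True
  then show ?thesis using assms by auto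
next
  case False
  then have t: "0 < t" "t < 1" using assms by auto
  have "\<eta> = \<eta> powr t * \<eta> powr (1 - t)" using \<eta> by (simp flip: powr_add)
  also have "\<dots> \<le> prob (box l) powr t * prob (box l') powr (1 - t)"
    using assms t \<eta> by (intro mult_mono powr_mono2) auto
  also have "\<dots> \<le> prob (box (\<lambda>k. t * l k + (1 - t) * l' k))"
    using t by (intro lc_closed closed_box box_comb box_events) auto
  finally show ?thesis .
qed

lemma box_superlevel_convex:
  assumes "finite S" "\<And>m. m \<in> S \<Longrightarrow> 0 \<le> w m" "(\<Sum>m\<in>S. w m) = 1"
    "\<And>m. m \<in> S \<Longrightarrow> \<eta> \<le> prob (box (l m))"
  shows "\<eta> \<le> prob (box (\<lambda>k. \<Sum>m\<in>S. w m * l m k))"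
  using assms
proof (induction S arbitrary: w rule: finite_induct)
  case empty
  then show ?case by simp
next
  case (insert x F)
  show ?case
  proof (cases "w x = 1")
    case True
    then have "(\<Sum>m\<in>F. w m) = 0" using insert by simp
    then have "\<forall>m\<in>F. w m = 0" using insert by (subst (asm) sum_nonneg_eq_0_iff) auto
    then have "(\<Sum>m\<in>insert x F. w m * l m k) = l x k" for k
      using insert True by simp
    then show ?thesis using insert by simp
  next
    case False
    have sF: "(\<Sum>m\<in>F. w m) = 1 - w x" using insert by simp
    moreover have "0 \<le> (\<Sum>m\<in>F. w m)" using insert by (intro sum_nonneg) auto
    ultimately have wx: "0 \<le> w x" "w x < 1" using False insert by auto
    have "\<eta> \<le> prob (box (\<lambda>k. \<Sum>m\<in>F. (w m / (1 - w x)) * l m k))"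
      using insert wx sF by (intro insert.IH) (auto simp flip: sum_divide_distrib)
    then have "\<eta> \<le> prob (box (\<lambda>k. w x * l x k + (1 - w x) * (\<Sum>m\<in>F. (w m / (1 - w x)) * l m k)))"
      using insert wx by (intro box_superlevel_comb) auto
    also have "(\<lambda>k. w x * l x k + (1 - w x) * (\<Sum>m\<in>F. (w m / (1 - w x)) * l m k))
        = (\<lambda>k. \<Sum>m\<in>insert x F. w m * l m k)"
      using insert wx by (auto simp: sum_distrib_left)
    finally show ?thesis .
  qed
qed

section \<open>Kept cells, their core and their centre\<close>

definition idx :: "(nat \<Rightarrow> int) set" where
  "idx = PiE {..<n} (\<lambda>_. {- int J..<int J})"

definition cell :: "(nat \<Rightarrow> int) \<Rightarrow> (nat \<Rightarrow> real) set" where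
  "cell m = box (\<lambda>k. r * real_of_int (m k))"

text \<open>Disjoint, so that measures add up; the closed \<open>cell\<close> is the version to
  which log-concavity for closed sets applies.\<close>

definition half_open_cell :: "(nat \<Rightarrow> int) \<Rightarrow> (nat \<Rightarrow> real) set" where
  "half_open_cell m = {x \<in> space M. \<forall>k<n. \<lfloor>\<phi> k x / r\<rfloor> = m k}"

definition heavy :: "(nat \<Rightarrow> int) set" where
  "heavy = {m \<in> idx. \<eta> \<le> prob (cell m)}"

definition core :: "(nat \<Rightarrow> real) set" where
  "core = (\<Union>m\<in>heavy. half_open_cell m)"

lemma finite_idx: "finite idx" "finite heavy"
  by (auto simp: idx_def heavy_def intro!: finite_PiE)

lemma card_idx: "card idx = (2 * J) ^ n"
proof -
  have "nat (2 * int J) = 2 * J" by simp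
  then show ?thesis by (simp add: idx_def card_PiE)
qed

lemma half_open_cell_events [measurable]: "half_open_cell m \<in> events"
  unfolding half_open_cell_def by measurable

lemma core_events [measurable]: "core \<in> events"
  unfolding core_def using finite_idx by auto

lemma half_open_cell_bounds:
  assumes "x \<in> half_open_cell m" "k < n"
  shows "r * real_of_int (m k) \<le> \<phi> k x" "\<phi> k x \<le> r * real_of_int (m k) + r"
proof -
  have "real_of_int (m k) \<le> \<phi> k x / r" "\<phi> k x / r \<le> real_of_int (m k) + 1"
  proof -
    have "m k = \<lfloor>\<phi> k x / r\<rfloor>" using assms by (simp add: half_open_cell_def)
    then show "real_of_int (m k) \<le> \<phi> k x / r" "\<phi> k x / r \<le> real_of_int (m k) + 1"
      by linarith+
  qed
  then show "r * real_of_int (m k) \<le> \<phi> k x" "\<phi> k x \<le> r * real_of_int (m k) + r"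
    using r0 by (simp_all add: field_simps)
qed

lemma half_open_cell_subset: "half_open_cell m \<subseteq> cell m"
  using half_open_cell_bounds by (auto simp: cell_def box_def half_open_cell_def)

lemma half_open_cell_disjoint:
  assumes "m \<in> idx" "m' \<in> idx" "m \<noteq> m'"
  shows "half_open_cell m \<inter> half_open_cell m' = {}"
proof -
  obtain k where "k < n" "m k \<noteq> m' k"
    using assms PiE_ext[of m "{..<n}" "\<lambda>_. {- int J..<int J}" m'] unfolding idx_def by blast
  then show ?thesis by (auto simp: half_open_cell_def)
qed

lemma \<phi>_tail: "k < n \<Longrightarrow> prob {x \<in> space M. L \<le> \<bar>\<phi> k x\<bar>} \<le> 1 / L\<^sup>2"
proof -
  assume k: "k < n"
  have "prob {x \<in> space M. L\<^sup>2 \<le> (\<phi> k x)\<^sup>2} \<le> expectation (\<lambda>x. (\<phi> k x)\<^sup>2) / L\<^sup>2"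
    using L by (intro integral_Markov_inequality_measure[where A = "{}"]) (auto simp: \<phi>_def)
  also have "expectation (\<lambda>x. (\<phi> k x)\<^sup>2) = 1"
    using orthonormal[OF k k] by (simp add: \<phi>_def power2_eq_square)
  also have "{x \<in> space M. L\<^sup>2 \<le> (\<phi> k x)\<^sup>2} = {x \<in> space M. L \<le> \<bar>\<phi> k x\<bar>}"
    using L abs_le_square_iff[of L] by auto
  finally show ?thesis .
qed

text \<open>Chebyshev for the \<open>n\<close> coordinates costs \<open>n / L^2\<close>, and at most
  \<open>(2 J)^n\<close> discarded cells have measure at most \<open>\<eta>\<close> each; either
  part is at most \<open>\<kappa> / 2\<close>.\<close>

lemma prob_core_compl: "prob (space M - core) \<le> \<kappa>"
proof -
  let ?A = "\<Union>k<n. {x \<in> space M. L \<le> \<bar>\<phi> k x\<bar>}"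
  let ?B = "\<Union>m\<in>idx - heavy. half_open_cell m"
  have "space M - core \<subseteq> ?A \<union> ?B"
  proof
    fix x assume x: "x \<in> space M - core"
    show "x \<in> ?A \<union> ?B"
    proof (cases "x \<in> ?A")
      case False
      define m where "m = restrict (\<lambda>k. \<lfloor>\<phi> k x / r\<rfloor>) {..<n}"
      have "m \<in> idx"
        unfolding idx_def m_def restrict_PiE_iff
      proof
        fix k assume "k \<in> {..<n}"
        then have "\<bar>\<phi> k x\<bar> < L" using False x by (auto simp: not_le)
        then have "\<bar>\<phi> k x\<bar> < real J * r" using L by linarith
        then have "- real J \<le> \<phi> k x / r" "\<phi> k x / r < real J"
          using r0 by (auto simp: field_simps abs_less_iff)
        then show "\<lfloor>\<phi> k x / r\<rfloor> \<in> {- int J..<int J}"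
          by (auto simp: le_floor_iff floor_less_iff)
      qed
      moreover have xm: "x \<in> half_open_cell m" using x by (auto simp: half_open_cell_def m_def)
      moreover have "m \<notin> heavy" using x xm by (auto simp: core_def)
      ultimately show ?thesis by blast
    qed auto
  qed
  then have "prob (space M - core) \<le> prob (?A \<union> ?B)"
    using finite_idx by (intro finite_measure_mono) (auto intro!: sets.Un sets.finite_UN)
  also have "\<dots> \<le> prob ?A + prob ?B"
    using finite_idx by (intro measure_Un_le) (auto intro!: sets.finite_UN)
  also have "prob ?A \<le> (\<Sum>k<n. prob {x \<in> space M. L \<le> \<bar>\<phi> k x\<bar>})"
    by (intro measure_UNION_le) auto
  also have "\<dots> \<le> (\<Sum>k<n. 1 / L\<^sup>2)" using \<phi>_tail by (intro sum_mono) auto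
  also have "\<dots> \<le> \<kappa> / 2" using L by simp
  also have "prob ?B \<le> (\<Sum>m\<in>idx - heavy. prob (half_open_cell m))"
    using finite_idx by (intro measure_UNION_le) auto
  also have "\<dots> \<le> (\<Sum>m\<in>idx - heavy. \<eta>)"
  proof (rule sum_mono)
    fix m assume "m \<in> idx - heavy"
    moreover have "prob (half_open_cell m) \<le> prob (cell m)"
      using half_open_cell_subset by (intro finite_measure_mono) (auto simp: cell_def)
    ultimately show "prob (half_open_cell m) \<le> \<eta>" by (auto simp: heavy_def)
  qed
  also have "\<dots> \<le> real (card idx) * \<eta>"
    using \<eta> finite_idx by (auto intro!: mult_right_mono card_mono)
  also have "\<dots> \<le> \<kappa> / 2" using \<eta> by (simp add: card_idx)
  finally show ?thesis by simp
qed

lemma prob_core: "1 - \<kappa> \<le> prob core"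
  using prob_core_compl prob_compl[OF core_events] by simp

text \<open>A finite convex combination of kept corners instead of the mean of \<open>\<phi>\<close>
  over \<open>core\<close>: convexity of the superlevel set then applies directly, at the price of
  an error \<open>r\<close>.\<close>

definition centre :: "nat \<Rightarrow> real" where
  "centre k = (\<Sum>m\<in>heavy. prob (half_open_cell m) / prob core * (r * real_of_int (m k)))"

lemma prob_core_sum: "prob core = (\<Sum>m\<in>heavy. prob (half_open_cell m))"
  unfolding core_def using finite_idx half_open_cell_disjoint
  by (intro finite_measure_finite_Union) (auto simp: disjoint_family_on_def heavy_def)

lemma prob_box_centre: "\<eta> \<le> prob (box centre)"
proof -
  have "0 < prob core" using prob_core \<kappa>_bounds by linarith
  then have "(\<Sum>m\<in>heavy. prob (half_open_cell m) / prob core) = 1"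
    by (simp add: prob_core_sum flip: sum_divide_distrib)
  then show ?thesis
    unfolding centre_def using finite_idx
    by (intro box_superlevel_convex) (auto simp: heavy_def cell_def)
qed

text \<open>The weights average the grid points of the heavy cells to within \<open>r\<close> of the conditional mean
  of \<open>\<phi>\<close> on \<open>core\<close>, which is nearly the global mean \<open>0\<close>.\<close>

lemma centre_bound:
  assumes k: "k < n"
  shows "\<bar>centre k\<bar> \<le> r + 2 * sqrt \<kappa>"
proof -
  let ?C = "space M - core"
  let ?g = "\<lambda>x. \<Sum>m\<in>heavy. r * real_of_int (m k) * indicator (half_open_cell m) x"
  have ii: "integrable M (indicat_real A)" if "A \<in> events" for A
    using that by (intro integrable_real_indicator) (auto simp: emeasure_eq_measure)
  have i\<phi>: "integrable M (\<phi> k)" "integrable M (\<lambda>x. (\<phi> k x)\<^sup>2)" by (auto simp: \<phi>_def)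
  have i\<phi>A: "integrable M (\<lambda>x. \<phi> k x * indicator A x)" if "A \<in> events" for A
    using that i\<phi> by (intro integrable_real_mult_indicator)
  have ig: "integrable M ?g"
    using ii by (intro Bochner_Integration.integrable_sum integrable_mult_right) auto
  have core_pos: "1/2 \<le> prob core" using prob_core \<kappa>_bounds by linarith
  have Eg: "prob core * centre k = expectation ?g"
  proof -
    have "expectation ?g = (\<Sum>m\<in>heavy. r * real_of_int (m k) * prob (half_open_cell m))"
      using ii by (subst Bochner_Integration.integral_sum) (auto simp: Int_absorb1 sets.sets_into_space)
    also have "\<dots> = prob core * centre k"
      using core_pos unfolding centre_def sum_distrib_left by (intro sum.cong) auto
    finally show ?thesis by simp
  qed
  have gd: "\<bar>?g x - \<phi> k x * indicator core x\<bar> \<le> r * indicator core x" for x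
  proof (cases "x \<in> core")
    case True
    then obtain m where m: "m \<in> heavy" "x \<in> half_open_cell m" by (auto simp: core_def)
    have "?g x = (\<Sum>m'\<in>heavy. if m' = m then r * real_of_int (m k) else 0)"
      using m half_open_cell_disjoint[of m] by (intro sum.cong) (auto simp: heavy_def indicator_def)
    also have "\<dots> = r * real_of_int (m k)" using m finite_idx by simp
    finally show ?thesis using True half_open_cell_bounds[OF m(2) k] by simp
  next
    case False
    then have "?g x = 0" by (intro sum.neutral) (auto simp: core_def indicator_def)
    then show ?thesis using False by simp
  qed
  have "\<bar>expectation ?g - expectation (\<lambda>x. \<phi> k x * indicator core x)\<bar>
      = \<bar>expectation (\<lambda>x. ?g x - \<phi> k x * indicator core x)\<bar>"
    using ig i\<phi>A by simp
  also have "\<dots> \<le> expectation (\<lambda>x. \<bar>?g x - \<phi> k x * indicator core x\<bar>)"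
    by (rule integral_abs_bound)
  also have "\<dots> \<le> expectation (\<lambda>x. r * indicator core x)"
    using gd ig i\<phi>A ii by (intro integral_mono integrable_abs Bochner_Integration.integrable_diff) auto
  also have "\<dots> = r * prob core" using sets.sets_into_space[OF core_events] by (simp add: Int_absorb1)
  finally have 1: "\<bar>expectation ?g - expectation (\<lambda>x. \<phi> k x * indicator core x)\<bar> \<le> r * prob core" .
  have "expectation (\<phi> k) = expectation (\<lambda>x. \<phi> k x * indicator core x + \<phi> k x * indicator ?C x)"
    by (intro Bochner_Integration.integral_cong) (auto simp: indicator_def)
  also have "\<dots> = expectation (\<lambda>x. \<phi> k x * indicator core x) + expectation (\<lambda>x. \<phi> k x * indicator ?C x)"
    by (intro Bochner_Integration.integral_add i\<phi>A) auto
  finally have 2: "expectation (\<lambda>x. \<phi> k x * indicator core x) = - expectation (\<lambda>x. \<phi> k x * indicator ?C x)"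
    using centred[OF k] by (simp add: \<phi>_def)
  have "\<bar>expectation (\<lambda>x. \<phi> k x * indicator ?C x)\<bar> \<le> expectation (\<lambda>x. \<bar>\<phi> k x * indicator ?C x\<bar>)"
    by (rule integral_abs_bound)
  \<comment> \<open>A weighted arithmetic-geometric mean in place of Cauchy-Schwarz; the weight
    \<open>sqrt \<kappa>\<close> balances \<open>E \<phi>^2 = 1\<close> against
    \<open>prob ?C <= \<kappa>\<close>.\<close>
  also have "\<dots> \<le> expectation (\<lambda>x. sqrt \<kappa> / 2 * (\<phi> k x)\<^sup>2 + 1 / (2 * sqrt \<kappa>) * indicator ?C x)"
  proof (rule integral_mono)
    fix x
    have "\<bar>y\<bar> \<le> sqrt \<kappa> / 2 * y\<^sup>2 + 1 / (2 * sqrt \<kappa>)" for y :: real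
    proof -
      define q where "q = sqrt \<kappa>"
      have q: "0 < q" using \<kappa> by (simp add: q_def)
      have "0 \<le> (q * \<bar>y\<bar> - 1)\<^sup>2 / (2 * q)" using q by simp
      also have "\<dots> = q / 2 * y\<^sup>2 + 1 / (2 * q) - \<bar>y\<bar>"
        using q by (simp add: power2_diff power_mult_distrib field_simps power2_eq_square)
      finally show ?thesis by (simp add: q_def)
    qed
    then show "\<bar>\<phi> k x * indicator ?C x\<bar> \<le> sqrt \<kappa> / 2 * (\<phi> k x)\<^sup>2 + 1 / (2 * sqrt \<kappa>) * indicator ?C x"
      using \<kappa> by (auto simp: indicator_def)
  qed (use i\<phi> i\<phi>A ii in \<open>auto intro!: integrable_abs Bochner_Integration.integrable_add\<close>)
  also have "\<dots> = sqrt \<kappa> / 2 * expectation (\<lambda>x. (\<phi> k x)\<^sup>2) + 1 / (2 * sqrt \<kappa>) * prob ?C"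
    using i\<phi> ii by (subst Bochner_Integration.integral_add) (auto simp: Int_absorb1)
  also have "\<dots> \<le> sqrt \<kappa> / 2 * 1 + 1 / (2 * sqrt \<kappa>) * \<kappa>"
    using orthonormal[OF k k] prob_core_compl \<kappa>
    by (intro add_mono mult_left_mono) (auto simp: \<phi>_def power2_eq_square)
  also have "\<dots> = sqrt \<kappa>" using \<kappa> by (simp add: field_simps real_sqrt_mult_self)
  finally have 3: "\<bar>expectation (\<lambda>x. \<phi> k x * indicator ?C x)\<bar> \<le> sqrt \<kappa>" .
  have "prob core * \<bar>centre k\<bar> = \<bar>expectation ?g\<bar>" using Eg by (metis abs_mult abs_of_nonneg measure_nonneg)
  also have "\<dots> \<le> r * prob core + sqrt \<kappa>" using 1 2 3 by linarith
  \<comment> \<open>The factor 2 comes from \<open>1/2 <= prob core\<close>.\<close>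
  also have "\<dots> \<le> r * prob core + prob core * (2 * sqrt \<kappa>)"
    using core_pos mult_right_mono[of "1/2" "prob core" "2 * sqrt \<kappa>"] \<kappa> by simp
  also have "\<dots> = prob core * (r + 2 * sqrt \<kappa>)" by (simp add: algebra_simps)
  finally show ?thesis using core_pos by (simp add: mult_le_cancel_left_pos)
qed

section \<open>The contracted set and the boxes that a sample must hit\<close>

definition deep :: "(nat \<Rightarrow> real) set" where
  "deep = (\<Union>m\<in>heavy. box (\<lambda>k. (1 - \<tau>) * (r * real_of_int (m k)) + \<tau> * centre k))"

text \<open>Replacing \<open>centre\<close> by the corner of \<open>m'\<close> in the piece of
  \<open>deep\<close> belonging to \<open>m\<close> gives this box, so the two differ by a shift of
  \<open>\<tau>\<close> times corner minus centre.\<close>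

definition target :: "(nat \<Rightarrow> int) \<Rightarrow> (nat \<Rightarrow> int) \<Rightarrow> (nat \<Rightarrow> real) set" where
  "target m m' = box (\<lambda>k. (1 - \<tau>) * (r * real_of_int (m k)) + \<tau> * (r * real_of_int (m' k)))"

lemma deep_events: "deep \<in> events"
  unfolding deep_def using finite_idx by auto

text \<open>Log-concavity for the union of the kept cells against \<open>box centre\<close>. The
  tiny box enters only with exponent \<open>\<tau>\<close>, so it costs just
  \<open>\<eta> powr \<tau>\<close>.\<close>

lemma prob_deep: "(1 - \<kappa>) * \<eta> powr \<tau> \<le> prob deep"
proof -
  have "1 - \<kappa> \<le> prob core" by (rule prob_core)
  also have "\<dots> \<le> prob (\<Union>m\<in>heavy. cell m)"
    unfolding core_def using finite_idx half_open_cell_subset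
    by (intro finite_measure_mono) (auto simp: cell_def)
  finally have c: "1 - \<kappa> \<le> prob (\<Union>m\<in>heavy. cell m)" .
  have k: "0 < 1 - \<kappa>" "1 - \<kappa> \<le> 1" using \<kappa>_bounds \<kappa> by auto
  have "1 - \<kappa> = (1 - \<kappa>) powr 1" using k by simp
  also have "\<dots> \<le> (1 - \<kappa>) powr (1 - \<tau>)" using k \<tau> by (intro powr_mono') auto
  also have "\<dots> \<le> prob (\<Union>m\<in>heavy. cell m) powr (1 - \<tau>)"
    using c k \<tau> by (intro powr_mono2) auto
  finally have "(1 - \<kappa>) * \<eta> powr \<tau> \<le> prob (\<Union>m\<in>heavy. cell m) powr (1 - \<tau>) * prob (box centre) powr \<tau>"
    using k \<tau> \<eta> prob_box_centre by (intro mult_mono powr_mono2) auto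
  also have "\<dots> = prob (\<Union>m\<in>heavy. cell m) powr (1 - \<tau>) * prob (box centre) powr (1 - (1 - \<tau>))"
    by simp
  also have "\<dots> \<le> prob deep"
  proof (rule lc_closed)
    show "closed (\<Union>m\<in>heavy. cell m)"
      using finite_idx by (auto simp: cell_def intro!: closed_box closed_UN)
    show "(\<Union>m\<in>heavy. cell m) \<in> events" using finite_idx by (auto simp: cell_def)
    fix x y assume "x \<in> (\<Union>m\<in>heavy. cell m)" and y: "y \<in> box centre"
    then obtain m where m: "m \<in> heavy" "x \<in> cell m" by blast
    show "restrict (\<lambda>i. (1 - \<tau>) * x i + (1 - (1 - \<tau>)) * y i) {..<n} \<in> deep"
      unfolding deep_def using box_comb[of x _ y centre "1 - \<tau>"] m y \<tau>
      by (intro UN_I[OF m(1)]) (auto simp: cell_def)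
  qed (use \<tau> deep_events in \<open>auto intro: closed_box\<close>)
  finally show ?thesis .
qed

lemma prob_target: "m \<in> heavy \<Longrightarrow> m' \<in> heavy \<Longrightarrow> \<eta> \<le> prob (target m m')"
  unfolding target_def
  using box_superlevel_comb[of "\<lambda>k. r * real_of_int (m k)" "\<lambda>k. r * real_of_int (m' k)" "1 - \<tau>"] \<tau>
  by (auto simp: heavy_def cell_def)

text \<open>The unit-variance form \<open>\<psi>\<close> is at least \<open>s\<close> on measure
  \<open>s^2 > \<kappa>\<close>, hence at some \<open>x\<close> in \<open>core\<close>, and
  \<open>m'\<close> is the cell of \<open>x\<close>. In \<phi>-coordinates \<open>y - z\<close> is
  close to \<open>\<tau>\<close> times \<open>x\<close> minus the centre, so \<open>\<psi>\<close>
  gains at least \<open>\<tau> s\<close>, less errors of at most half of that.\<close>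

lemma exists_target_beyond:
  assumes t: "(\<Sum>k<n. (t k)\<^sup>2) = 1" and m: "m \<in> heavy"
    and z: "z \<in> box (\<lambda>k. (1 - \<tau>) * (r * real_of_int (m k)) + \<tau> * centre k)"
  shows "\<exists>m'\<in>heavy. \<forall>y\<in>target m m'. (\<Sum>k<n. t k * \<phi> k z) < (\<Sum>k<n. t k * \<phi> k y)"
proof -
  define \<psi> where "\<psi> x = (\<Sum>k<n. t k * \<phi> k x)" for x
  have \<psi>: "\<psi> = affine_form n (\<lambda>i. \<Sum>k<n. t k * a k i) (\<Sum>k<n. t k * b k)"
    unfolding \<psi>_def \<phi>_def affine_form_sum ..
  have t1: "\<bar>t k\<bar> \<le> 1" if "k < n" for k
  proof -
    have "(t k)\<^sup>2 \<le> (\<Sum>k<n. (t k)\<^sup>2)" using that by (intro member_le_sum) auto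
    then show ?thesis using t by (simp add: abs_square_le_1)
  qed
  have i1: "integrable M (\<phi> k)" and i2: "integrable M (\<lambda>w. \<phi> j w * \<phi> k w)" for j k
    by (auto simp: \<phi>_def)
  have E1: "expectation \<psi> = 0"
    unfolding \<psi>_def using i1 centred by (simp add: \<phi>_def)
  have "(\<lambda>w. (\<psi> w)\<^sup>2) = (\<lambda>w. \<Sum>j<n. \<Sum>k<n. t j * t k * (\<phi> j w * \<phi> k w))"
    by (intro ext) (simp add: \<psi>_def power2_eq_square sum_product mult_ac)
  then have "expectation (\<lambda>w. (\<psi> w)\<^sup>2) = (\<Sum>j<n. \<Sum>k<n. t j * t k * expectation (\<lambda>w. \<phi> j w * \<phi> k w))"
    using i2 by simp
  also have "\<dots> = (\<Sum>j<n. \<Sum>k<n. if j = k then t j * t k else 0)"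
    using orthonormal by (intro sum.cong) (auto simp: \<phi>_def)
  also have "\<dots> = 1" using t by (simp add: power2_eq_square)
  finally have E2: "expectation (\<lambda>w. (\<psi> w)\<^sup>2) = 1" .
  have "s\<^sup>2 \<le> prob {w \<in> space M. s \<le> \<psi> w}"
    using one_sided E1 E2 unfolding \<psi> by simp
  then have "\<not> {w \<in> space M. s \<le> \<psi> w} \<subseteq> space M - core"
    using finite_measure_mono[of "{w \<in> space M. s \<le> \<psi> w}" "space M - core"] prob_core_compl \<kappa>_bounds
    by auto
  then obtain x where x: "x \<in> core" "s \<le> \<psi> x" by blast
  then obtain m' where m': "m' \<in> heavy" "x \<in> half_open_cell m'" by (auto simp: core_def)
  have "\<psi> z < \<psi> y" if y: "y \<in> target m m'" for y
  proof -
    have "\<tau> * (t k * \<phi> k x) - (2 * r + \<tau> * (r + 2 * sqrt \<kappa>)) \<le> t k * \<phi> k y - t k * \<phi> k z"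
      if k: "k < n" for k
    proof -
      let ?l = "(1 - \<tau>) * (r * real_of_int (m k))" and ?l' = "r * real_of_int (m' k)"
      \<comment> \<open>Deviation from the ideal displacement \<open>\<tau> \<phi> k x\<close>: one
        \<open>r\<close> for the positions of \<open>y\<close> and \<open>z\<close> in their boxes,
        one for rounding \<open>x\<close> to its corner, and \<open>\<tau>\<close> times the bound
        on the centre.\<close>
      define d where "d = \<phi> k y - \<phi> k z - \<tau> * \<phi> k x"
      have "?l + \<tau> * ?l' \<le> \<phi> k y" "\<phi> k y \<le> ?l + \<tau> * ?l' + r"
        "?l + \<tau> * centre k \<le> \<phi> k z" "\<phi> k z \<le> ?l + \<tau> * centre k + r"
        using y z k by (auto simp: target_def box_def)
      moreover have "\<bar>\<tau> * centre k\<bar> \<le> \<tau> * (r + 2 * sqrt \<kappa>)"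
        using centre_bound[OF k] \<tau> by (simp add: abs_mult)
      moreover have "\<tau> * ?l' \<le> \<tau> * \<phi> k x" "\<tau> * \<phi> k x \<le> \<tau> * (?l' + r)"
        using half_open_cell_bounds[OF m'(2) k] \<tau> by (auto intro!: mult_left_mono)
      moreover have "\<tau> * (?l' + r) \<le> \<tau> * ?l' + r"
        using \<tau> r0 by (simp add: distrib_left)
      ultimately have "\<bar>d\<bar> \<le> 2 * r + \<tau> * (r + 2 * sqrt \<kappa>)"
        unfolding d_def by linarith
      then have "\<bar>t k\<bar> * \<bar>d\<bar> \<le> 1 * (2 * r + \<tau> * (r + 2 * sqrt \<kappa>))"
        using t1[OF k] by (intro mult_mono) auto
      then have "- (2 * r + \<tau> * (r + 2 * sqrt \<kappa>)) \<le> t k * d"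
        unfolding abs_mult[symmetric] mult_1 by linarith
      moreover have "t k * d = t k * \<phi> k y - t k * \<phi> k z - \<tau> * (t k * \<phi> k x)"
        by (simp add: d_def algebra_simps)
      ultimately show ?thesis by simp
    qed
    then have "(\<Sum>k<n. \<tau> * (t k * \<phi> k x) - (2 * r + \<tau> * (r + 2 * sqrt \<kappa>)))
        \<le> (\<Sum>k<n. t k * \<phi> k y - t k * \<phi> k z)"
      by (intro sum_mono) auto
    then have 1: "\<tau> * \<psi> x - real n * (2 * r + \<tau> * (r + 2 * sqrt \<kappa>)) \<le> \<psi> y - \<psi> z"
      by (simp add: \<psi>_def sum_subtractf sum_distrib_left)
    have "\<tau> * r \<le> r" using \<tau> r0 by simp
    then have "real n * (2 * r + \<tau> * (r + 2 * sqrt \<kappa>)) \<le> real n * (3 * r + \<tau> * (2 * sqrt \<kappa>))"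
      by (intro mult_left_mono) (auto simp: distrib_left)
    also have "\<dots> \<le> real n * (3 * r + \<tau> * (2 * (s / (8 * real n))))"
      using \<kappa> \<tau> by (intro mult_left_mono add_left_mono) auto
    also have "\<dots> = \<tau> * s / 2" using n0 by (simp add: r field_simps)
    finally have 2: "real n * (2 * r + \<tau> * (r + 2 * sqrt \<kappa>)) \<le> \<tau> * s / 2" .
    have "\<tau> * s \<le> \<tau> * \<psi> x" using x \<tau> by simp
    moreover have "0 < \<tau> * s" using \<tau> s by simp
    ultimately show ?thesis using 1 2 by linarith
  qed
  then show ?thesis using m'(1) by (auto simp: \<psi>_def)
qed

text \<open>A point outside the hull is strictly separated from all sample points, yet some target
  lies entirely beyond it in the separating direction and contains a sample point.\<close>

lemma deep_subset_conv:
  assumes X: "\<And>m m'. m \<in> heavy \<Longrightarrow> m' \<in> heavy \<Longrightarrow> \<exists>j<N. X j \<in> target m m'"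
  shows "deep \<subseteq> conv_pts n N X"
proof
  fix z assume "z \<in> deep"
  then obtain m where m: "m \<in> heavy" and z: "z \<in> box (\<lambda>k. (1 - \<tau>) * (r * real_of_int (m k)) + \<tau> * centre k)"
    by (auto simp: deep_def)
  have zR: "z \<in> Rn n" using z by (simp add: box_def space_M)
  show "z \<in> conv_pts n N X"
  proof (rule ccontr)
    assume "z \<notin> conv_pts n N X"
    then obtain \<theta> where \<theta>: "\<forall>j<N. (\<Sum>i<n. \<theta> i * X j i) < (\<Sum>i<n. \<theta> i * z i)"
      using conv_pts_separation[OF zR] by blast
    obtain t c where tc: "\<And>x. (\<Sum>i<n. \<theta> i * x i) = c + (\<Sum>j<n. t j * \<phi> j x)"
      using spanning[of \<theta>] by (auto simp: \<phi>_def)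
    have lt: "(\<Sum>k<n. t k * \<phi> k (X j)) < (\<Sum>k<n. t k * \<phi> k z)" if "j < N" for j
      using \<theta> that unfolding tc by simp
    define S where "S = (\<Sum>k<n. (t k)\<^sup>2)"
    \<comment> \<open>With \<open>S = 0\<close> the separating functional would be constant, against
      strict separation from a sample point; one exists because \<open>target m m\<close> is
      hit.\<close>
    have "0 < S"
    proof (rule ccontr)
      assume "\<not> 0 < S"
      moreover have "0 \<le> S" by (simp add: S_def sum_nonneg)
      ultimately have "\<forall>k<n. t k = 0" unfolding S_def by (subst (asm) (2) order.antisym[of _ 0]) (auto simp: sum_nonneg_eq_0_iff)
      then have "(\<Sum>k<n. t k * f k) = 0" for f :: "nat \<Rightarrow> real" by (intro sum.neutral) auto
      moreover obtain j where "j < N" using X[OF m m] by blast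
      ultimately show False using lt by simp
    qed
    then have "(\<Sum>k<n. (t k / sqrt S)\<^sup>2) = 1"
      by (simp add: power_divide flip: sum_divide_distrib) (simp add: S_def)
    then obtain m' where m': "m' \<in> heavy"
      and y: "\<forall>y\<in>target m m'. (\<Sum>k<n. t k / sqrt S * \<phi> k z) < (\<Sum>k<n. t k / sqrt S * \<phi> k y)"
      using exists_target_beyond[of "\<lambda>k. t k / sqrt S", OF _ m z] by auto
    obtain j where j: "j < N" "X j \<in> target m m'" using X[OF m m'] by blast
    have "(\<Sum>k<n. t k * \<phi> k z) / sqrt S < (\<Sum>k<n. t k * \<phi> k (X j)) / sqrt S"
      using y j(2) by (simp add: sum_divide_distrib)
    then show False using lt[OF j(1)] \<open>0 < S\<close> by (simp add: divide_less_cancel)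
  qed
qed

text \<open>Pairs of kept indices give at most \<open>((2 J)^n)^2\<close> targets; the hypothesis
  keeps the first factor nonnegative.\<close>

lemma expected_hull_measure_grid:
  assumes "real (2 * J) ^ (2 * n) * (1 - \<eta>) ^ N \<le> 1"
  shows "(1 - real (2 * J) ^ (2 * n) * (1 - \<eta>) ^ N) * ((1 - \<kappa>) * \<eta> powr \<tau>)
    \<le> expected_hull_measure n M N"
proof -
  let ?\<T> = "(\<lambda>(m, m'). target m m') ` (heavy \<times> heavy)"
  have \<eta>1: "\<eta> \<le> 1" using prob_box_centre prob_le_1 order_trans by blast
  have "card ?\<T> \<le> card (heavy \<times> heavy)" using finite_idx by (intro card_image_le) auto
  also have "\<dots> \<le> card (idx \<times> idx)"
    using finite_idx by (intro card_mono) (auto simp: heavy_def)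
  also have "\<dots> = (2 * J) ^ (2 * n)"
    by (simp add: card_cartesian_product card_idx power_add[symmetric] mult_2)
  finally have "real (card ?\<T>) \<le> real (2 * J) ^ (2 * n)"
    by (metis of_nat_le_iff of_nat_power)
  then have le: "real (card ?\<T>) * (1 - \<eta>) ^ N \<le> real (2 * J) ^ (2 * n) * (1 - \<eta>) ^ N"
    using \<eta>1 by (intro mult_right_mono) auto
  have "(1 - real (2 * J) ^ (2 * n) * (1 - \<eta>) ^ N) * ((1 - \<kappa>) * \<eta> powr \<tau>)
      \<le> (1 - real (card ?\<T>) * (1 - \<eta>) ^ N) * prob deep"
    using le assms prob_deep \<kappa>_bounds \<eta> by (intro mult_mono) auto
  also have "\<dots> \<le> expected_hull_measure n M N"
    using finite_idx \<eta> \<eta>1 deep_events prob_target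
  proof (intro expected_hull_measure_ge)
    fix X assume hit: "\<And>T. T \<in> ?\<T> \<Longrightarrow> \<exists>j<N. X j \<in> T"
    show "deep \<subseteq> conv_pts n N X" by (rule deep_subset_conv, rule hit) auto
  qed (auto simp: target_def)
  finally show ?thesis .
qed

end

section \<open>The uniform measure on the cube\<close>

text \<open>A real infimum over the empty set is unspecified, so the statement needs a log-concave
  measure to exist in every dimension. The Brunn--Minkowski inequality for the cube is proved by
  induction on the dimension, with the one-dimensional Prekopa--Leindler inequality applied to the
  measures of slices.\<close>

definition unif :: "real measure" where
  "unif = uniform_measure lborel {0..1}"

lemma sets_unif [measurable_cong, simp]: "sets unif = sets borel" and space_unif [simp]: "space unif = UNIV"
  by (simp_all add: unif_def)

interpretation unif: prob_space unif
  unfolding unif_def by (intro prob_space_uniform_measure) auto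

lemma emeasure_unif: "A \<in> sets borel \<Longrightarrow> emeasure unif A = emeasure lborel ({0..1} \<inter> A)"
  by (simp add: unif_def divide_ennreal_def)

lemma measure_unif: "A \<in> sets borel \<Longrightarrow> measure unif A = measure lborel (A \<inter> {0..1})"
  by (simp add: emeasure_unif measure_def Int_commute)

lemma AE_unif: "AE x in unif. 0 < x \<and> x < 1"
proof -
  have "AE x in lborel. x \<notin> {0, 1::real}"
    by (intro AE_not_in finite_imp_null_set_lborel) auto
  then have "AE x in lborel. x \<in> {0..1::real} \<longrightarrow> 0 < x \<and> x < 1"
    by (rule eventually_mono) auto
  then show ?thesis
    unfolding unif_def by (intro AE_uniform_measureI) auto
qed

section \<open>Brunn-Minkowski and Prekopa-Leindler on the unit interval\<close>

lemma measure_lborel_affine_image: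
  fixes c d :: real
  assumes B [measurable]: "B \<in> sets borel" and c: "0 < c"
  shows "emeasure lborel {u. (u - d) / c \<in> B} = ennreal c * emeasure lborel B"
proof -
  have "emeasure lborel {u. (u - d) / c \<in> B} = (\<integral>\<^sup>+u. indicator {u. (u - d) / c \<in> B} u \<partial>lborel)"
    by (intro nn_integral_indicator[symmetric]) measurable
  also have "\<dots> = ennreal \<bar>c\<bar> * (\<integral>\<^sup>+u. indicator {u. (u - d) / c \<in> B} (d + c * u) \<partial>lborel)"
    using c by (intro nn_integral_real_affine) auto
  also have "(\<integral>\<^sup>+u. indicator {u. (u - d) / c \<in> B} (d + c * u) \<partial>lborel) = (\<integral>\<^sup>+u. indicator B u \<partial>lborel)"
    using c by (intro nn_integral_cong) (auto simp: indicator_def)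
  finally show ?thesis using c by simp
qed

text \<open>The translates \<open>t sup A + (1 - t) B\<close> and \<open>t A + (1 - t) inf B\<close> overlap in one point; since
  the extrema need not be attained, they are replaced by approximations.\<close>

lemma brunn_minkowski_unif:
  assumes A: "A \<in> sets borel" and B: "B \<in> sets borel" and C: "C \<in> sets borel"
    and t: "0 < t" "t < 1" and ne: "A \<inter> {0..1} \<noteq> {}" "B \<inter> {0..1} \<noteq> {}"
    and comb: "\<And>x y. x \<in> A \<inter> {0..1} \<Longrightarrow> y \<in> B \<inter> {0..1} \<Longrightarrow> t * x + (1 - t) * y \<in> C"
  shows "t * measure unif A + (1 - t) * measure unif B \<le> measure unif C"
proof (rule field_le_epsilon)
  fix e :: real assume e: "0 < e"
  define A' B' where "A' = A \<inter> {0..1}" and "B' = B \<inter> {0..1}"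
  have [measurable]: "A' \<in> sets borel" "B' \<in> sets borel" using A B by (auto simp: A'_def B'_def)
  have bd: "bdd_above A'" "bdd_below B'"
    by (auto simp: A'_def B'_def intro!: bdd_aboveI[of _ 1] bdd_belowI[of _ 0])
  obtain a where a: "a \<in> A'" "Sup A' - e < a"
    using less_cSup_iff[of A' "Sup A' - e"] bd ne(1) e unfolding A'_def[symmetric] by auto
  obtain b where b: "b \<in> B'" "b < Inf B' + e"
    using cInf_less_iff[of B' "Inf B' + e"] bd ne(2) e unfolding B'_def[symmetric] by auto
  define U V where "U = {u. (u - t * a) / (1 - t) \<in> B'}" and "V = {u. (u - (1 - t) * b) / t \<in> A'}"
  have [measurable]: "U \<in> sets borel" "V \<in> sets borel" unfolding U_def V_def by measurable
  have UV: "U \<union> V \<subseteq> C \<inter> {0..1}"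
  proof -
    have mem: "t * x + (1 - t) * y \<in> C \<inter> {0..1}" if "x \<in> A'" "y \<in> B'" for x y
    proof -
      have xy: "0 \<le> x" "x \<le> 1" "0 \<le> y" "y \<le> 1" using that by (auto simp: A'_def B'_def)
      have "t * x + (1 - t) * y \<le> t * 1 + (1 - t) * 1"
        using xy t by (intro add_mono mult_left_mono) auto
      then show ?thesis using comb[of x y] that xy t by (auto simp: A'_def B'_def)
    qed
    have "u \<in> C \<inter> {0..1}" if "u \<in> U" for u
      using mem[OF a(1), of "(u - t * a) / (1 - t)"] that t by (simp add: U_def)
    moreover have "u \<in> C \<inter> {0..1}" if "u \<in> V" for u
      using mem[OF _ b(1), of "(u - (1 - t) * b) / t"] that t by (simp add: V_def)
    ultimately show ?thesis by blast
  qed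
  have fin: "S \<in> fmeasurable lborel" if "S \<in> sets borel" "S \<subseteq> {0..1}" for S :: "real set"
    using that by (intro fmeasurableI2[OF fmeasurable_compact[OF compact_Icc]]) auto
  have mU: "measure lborel U = (1 - t) * measure lborel B'"
    unfolding U_def measure_def using t by (subst measure_lborel_affine_image) (auto simp: enn2real_mult)
  have mV: "measure lborel V = t * measure lborel A'"
    unfolding V_def measure_def using t by (subst measure_lborel_affine_image) (auto simp: enn2real_mult)
  have sub: "U \<inter> V \<subseteq> {t * a + (1 - t) * Inf B'..t * Sup A' + (1 - t) * b}"
  proof
    fix u assume "u \<in> U \<inter> V"
    then have "Inf B' \<le> (u - t * a) / (1 - t)" "(u - (1 - t) * b) / t \<le> Sup A'"
      using bd by (auto simp: U_def V_def intro!: cInf_lower cSup_upper)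
    then show "u \<in> {t * a + (1 - t) * Inf B'..t * Sup A' + (1 - t) * b}"
      using t by (simp add: field_simps)
  qed
  have "measure lborel (U \<inter> V) \<le> measure lborel {t * a + (1 - t) * Inf B'..t * Sup A' + (1 - t) * b}"
    using sub by (intro measure_mono_fmeasurable fmeasurable_compact) auto
  also have "\<dots> \<le> e"
  proof -
    have "t * Sup A' + (1 - t) * b - (t * a + (1 - t) * Inf B') = t * (Sup A' - a) + (1 - t) * (b - Inf B')"
      by (simp add: algebra_simps)
    also have "\<dots> \<le> t * e + (1 - t) * e" using a b t by (intro add_mono mult_left_mono) auto
    finally show ?thesis using e by (simp add: algebra_simps)
  qed
  finally have "measure lborel (U \<inter> V) \<le> e" .
  moreover have "measure lborel (U \<union> V) = measure lborel U + measure lborel V - measure lborel (U \<inter> V)"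
    using UV by (intro measure_Un3 fin) auto
  moreover have "measure lborel (U \<union> V) \<le> measure lborel (C \<inter> {0..1})"
    using UV C by (intro measure_mono_fmeasurable fin) auto
  ultimately show "t * measure unif A + (1 - t) * measure unif B \<le> measure unif C + e"
    using A B C mU mV by (simp add: measure_unif A'_def B'_def)
qed

text \<open>Fubini on the unit square; levels may be drawn from \<open>unif\<close> because
  \<open>u\<close> maps into [0, 1] there. Strict superlevel sets serve \<open>f\<close> and
  \<open>g\<close>, non-strict ones \<open>h\<close>, since the pointwise hypothesis yields only a
  non-strict bound.\<close>

lemma layer_cake_unif:
  assumes u [measurable]: "u \<in> borel_measurable borel" and u01: "\<And>x. x \<in> {0..1} \<Longrightarrow> 0 \<le> u x \<and> u x \<le> (1::real)"
  shows "(\<integral>\<^sup>+s. emeasure unif {x. s < u x} \<partial>unif) = (\<integral>\<^sup>+x. ennreal (u x) \<partial>unif)"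
    and "(\<integral>\<^sup>+s. emeasure unif {x. s \<le> u x} \<partial>unif) = (\<integral>\<^sup>+x. ennreal (u x) \<partial>unif)"
proof -
  interpret pair_sigma_finite unif unif ..
  have e: "emeasure unif {s. s < u x} = ennreal (u x)" "emeasure unif {s. s \<le> u x} = ennreal (u x)"
    if "0 < x \<and> x < 1" for x
  proof -
    have "{0..1} \<inter> {s. s < u x} = {0..<u x}" "{0..1} \<inter> {s. s \<le> u x} = {0..u x}"
      using u01[of x] that by auto
    then show "emeasure unif {s. s < u x} = ennreal (u x)" "emeasure unif {s. s \<le> u x} = ennreal (u x)"
      using u01[of x] that by (auto simp: emeasure_unif)
  qed
  have "(\<integral>\<^sup>+s. emeasure unif {x. s < u x} \<partial>unif) = (\<integral>\<^sup>+s. \<integral>\<^sup>+x. indicator {p. fst p < u (snd p)} (s, x) \<partial>unif \<partial>unif)"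
    by (intro nn_integral_cong) (auto simp flip: nn_integral_indicator intro!: nn_integral_cong simp: indicator_def)
  also have "\<dots> = (\<integral>\<^sup>+x. \<integral>\<^sup>+s. indicator {p. fst p < u (snd p)} (s, x) \<partial>unif \<partial>unif)"
    by (rule Fubini'[symmetric]) measurable
  also have "\<dots> = (\<integral>\<^sup>+x. emeasure unif {s. s < u x} \<partial>unif)"
    by (intro nn_integral_cong) (auto simp flip: nn_integral_indicator intro!: nn_integral_cong simp: indicator_def)
  also have "\<dots> = (\<integral>\<^sup>+x. ennreal (u x) \<partial>unif)"
    by (intro nn_integral_cong_AE eventually_mono[OF AE_unif] e)
  finally show "(\<integral>\<^sup>+s. emeasure unif {x. s < u x} \<partial>unif) = (\<integral>\<^sup>+x. ennreal (u x) \<partial>unif)" .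
  have "(\<integral>\<^sup>+s. emeasure unif {x. s \<le> u x} \<partial>unif) = (\<integral>\<^sup>+s. \<integral>\<^sup>+x. indicator {p. fst p \<le> u (snd p)} (s, x) \<partial>unif \<partial>unif)"
    by (intro nn_integral_cong) (auto simp flip: nn_integral_indicator intro!: nn_integral_cong simp: indicator_def)
  also have "\<dots> = (\<integral>\<^sup>+x. \<integral>\<^sup>+s. indicator {p. fst p \<le> u (snd p)} (s, x) \<partial>unif \<partial>unif)"
    by (rule Fubini'[symmetric]) measurable
  also have "\<dots> = (\<integral>\<^sup>+x. emeasure unif {s. s \<le> u x} \<partial>unif)"
    by (intro nn_integral_cong) (auto simp flip: nn_integral_indicator intro!: nn_integral_cong simp: indicator_def)
  also have "\<dots> = (\<integral>\<^sup>+x. ennreal (u x) \<partial>unif)"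
    by (intro nn_integral_cong_AE eventually_mono[OF AE_unif] e)
  finally show "(\<integral>\<^sup>+s. emeasure unif {x. s \<le> u x} \<partial>unif) = (\<integral>\<^sup>+x. ennreal (u x) \<partial>unif)" .
qed

lemma integrable_unif:
  fixes f :: "real \<Rightarrow> real"
  assumes [measurable]: "f \<in> borel_measurable borel" and "\<And>x. 0 \<le> f x \<and> f x \<le> c"
  shows "integrable unif f"
  using assms by (intro unif.integrable_const_bound[where B = c]) auto

text \<open>Dividing by the suprema makes the superlevel sets of both functions nonempty at every
  level in (0, 1), so the additive inequality for sets applies level by level. Integration gives an
  arithmetic mean, which Young's inequality bounds below by the geometric one.\<close>

lemma prekopa_leindler_unif:
  fixes f g h :: "real \<Rightarrow> real"
  assumes meas [measurable]: "f \<in> borel_measurable borel" "g \<in> borel_measurable borel" "h \<in> borel_measurable borel"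
    and f01: "\<And>x. 0 \<le> f x \<and> f x \<le> 1" and g01: "\<And>x. 0 \<le> g x \<and> g x \<le> 1" and h01: "\<And>x. 0 \<le> h x \<and> h x \<le> 1"
    and t: "0 < t" "t < 1"
    and fgh: "\<And>x y. f x powr t * g y powr (1 - t) \<le> h (t * x + (1 - t) * y)"
  shows "(\<integral>x. f x \<partial>unif) powr t * (\<integral>x. g x \<partial>unif) powr (1 - t) \<le> (\<integral>x. h x \<partial>unif)"
proof (cases "(\<integral>x. f x \<partial>unif) = 0 \<or> (\<integral>x. g x \<partial>unif) = 0")
  case True
  then show ?thesis using h01 by auto
next
  case False
  have int: "integrable unif f" "integrable unif g" "integrable unif h"
    using f01 g01 h01 by (auto intro!: integrable_unif[where c = 1])
  have pos: "0 < (\<integral>x. f x \<partial>unif)" "0 < (\<integral>x. g x \<partial>unif)"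
    using False f01 g01 by (auto simp: less_le)
  have sup: "\<exists>F>0. (\<forall>x\<in>{0..1}. k x \<le> F) \<and> (\<forall>s<1. 0 < s \<longrightarrow> (\<exists>x\<in>{0..1}. s * F < k x))"
    if k01: "\<And>x. 0 \<le> k x \<and> k x \<le> 1" and kpos: "0 < (\<integral>x. k x \<partial>unif)" for k :: "real \<Rightarrow> real"
  proof -
    define F where "F = (SUP x\<in>{0..1}. k x)"
    have bd: "bdd_above (k ` {0..1})" using k01 by (auto intro!: bdd_aboveI[of _ 1])
    have up: "k x \<le> F" if "x \<in> {0..1}" for x unfolding F_def using that bd by (rule cSUP_upper)
    have "0 < F"
    proof (rule ccontr)
      assume "\<not> 0 < F"
      have "AE x in unif. k x = 0"
      proof (rule eventually_mono[OF AE_unif])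
        fix x :: real assume "0 < x \<and> x < 1"
        then have "k x \<le> F" by (intro up) auto
        then show "k x = 0" using k01[of x] \<open>\<not> 0 < F\<close> by linarith
      qed
      then have "(\<integral>x. k x \<partial>unif) = 0" by (rule integral_eq_zero_AE)
      then show False using kpos by simp
    qed
    moreover have "\<exists>x\<in>{0..1}. s * F < k x" if "s < 1" "0 < s" for s
      using less_cSUP_iff[OF _ bd, of "s * F"] \<open>0 < F\<close> that by (auto simp: F_def[symmetric])
    ultimately show ?thesis using up by blast
  qed
  obtain F where F: "0 < F" "\<And>x. x \<in> {0..1} \<Longrightarrow> f x \<le> F" "\<And>s. s < 1 \<Longrightarrow> 0 < s \<Longrightarrow> \<exists>x\<in>{0..1}. s * F < f x"
    using sup[of f] f01 pos by blast
  obtain G where G: "0 < G" "\<And>x. x \<in> {0..1} \<Longrightarrow> g x \<le> G" "\<And>s. s < 1 \<Longrightarrow> 0 < s \<Longrightarrow> \<exists>x\<in>{0..1}. s * G < g x"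
    using sup[of g] g01 pos by blast
  define H where "H = F powr t * G powr (1 - t)"
  have H: "0 < H" using F G by (simp add: H_def)
  \<comment> \<open>The cap at 1 brings \<open>h / H\<close> into the range of the layer-cake
    formula and is harmless for levels below 1.\<close>
  have level: "ennreal t * emeasure unif {x. s < f x / F} + ennreal (1 - t) * emeasure unif {x. s < g x / G}
      \<le> emeasure unif {x. s \<le> min 1 (h x / H)}" if s: "0 < s" "s < 1" for s
  proof -
    have "t * measure unif {x. s < f x / F} + (1 - t) * measure unif {x. s < g x / G}
        \<le> measure unif {x. s \<le> min 1 (h x / H)}"
    proof (rule brunn_minkowski_unif)
      show "{x. s < f x / F} \<inter> {0..1} \<noteq> {}" using F(3)[OF s(2,1)] F(1) by (auto simp: pos_less_divide_eq)
      show "{x. s < g x / G} \<inter> {0..1} \<noteq> {}" using G(3)[OF s(2,1)] G(1) by (auto simp: pos_less_divide_eq)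
      fix x y assume "x \<in> {x. s < f x / F} \<inter> {0..1}" "y \<in> {x. s < g x / G} \<inter> {0..1}"
      then have xy: "s * F \<le> f x" "s * G \<le> g y" using F G by (auto simp: pos_less_divide_eq)
      have "s * H = (s powr t * s powr (1 - t)) * H" using s by (simp flip: powr_add)
      also have "\<dots> = (s * F) powr t * (s * G) powr (1 - t)"
        using s F G by (simp add: H_def powr_mult)
      also have "\<dots> \<le> f x powr t * g y powr (1 - t)"
        using xy s F G t by (intro mult_mono powr_mono2) auto
      also have "\<dots> \<le> h (t * x + (1 - t) * y)" by (rule fgh)
      finally show "t * x + (1 - t) * y \<in> {x. s \<le> min 1 (h x / H)}"
        using s H by (simp add: pos_le_divide_eq)
    qed (use t in measurable)
    then show ?thesis
      using t by (simp add: unif.emeasure_eq_measure flip: ennreal_mult ennreal_plus)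
  qed
  have "ennreal t * (\<integral>\<^sup>+x. ennreal (f x / F) \<partial>unif) + ennreal (1 - t) * (\<integral>\<^sup>+x. ennreal (g x / G) \<partial>unif)
      = ennreal t * (\<integral>\<^sup>+s. emeasure unif {x. s < f x / F} \<partial>unif)
        + ennreal (1 - t) * (\<integral>\<^sup>+s. emeasure unif {x. s < g x / G} \<partial>unif)"
    using F G f01 g01 by (subst (1 2) layer_cake_unif(1)) auto
  also have "\<dots> = (\<integral>\<^sup>+s. ennreal t * emeasure unif {x. s < f x / F}
        + ennreal (1 - t) * emeasure unif {x. s < g x / G} \<partial>unif)"
    by (subst nn_integral_add) (auto simp: nn_integral_cmult)
  also have "\<dots> \<le> (\<integral>\<^sup>+s. emeasure unif {x. s \<le> min 1 (h x / H)} \<partial>unif)"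
    by (intro nn_integral_mono_AE eventually_mono[OF AE_unif] level) auto
  also have "\<dots> = (\<integral>\<^sup>+x. ennreal (min 1 (h x / H)) \<partial>unif)"
    using h01 H by (intro layer_cake_unif(2)) auto
  also have "\<dots> \<le> (\<integral>\<^sup>+x. ennreal (h x / H) \<partial>unif)"
    by (intro nn_integral_mono ennreal_leI) auto
  finally have "t * ((\<integral>x. f x \<partial>unif) / F) + (1 - t) * ((\<integral>x. g x \<partial>unif) / G) \<le> (\<integral>x. h x \<partial>unif) / H"
    using int F G H f01 g01 h01 t
    by (simp add: nn_integral_eq_integral flip: ennreal_mult ennreal_plus)
  moreover have "((\<integral>x. f x \<partial>unif) / F) powr t * ((\<integral>x. g x \<partial>unif) / G) powr (1 - t)
      \<le> t * ((\<integral>x. f x \<partial>unif) / F) + (1 - t) * ((\<integral>x. g x \<partial>unif) / G)"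
    using t pos F G by (intro Youngs_inequality_0) auto
  moreover have "((\<integral>x. f x \<partial>unif) / F) powr t * ((\<integral>x. g x \<partial>unif) / G) powr (1 - t)
      = ((\<integral>x. f x \<partial>unif) powr t * (\<integral>x. g x \<partial>unif) powr (1 - t)) / H"
    using F G pos by (simp add: H_def powr_divide)
  ultimately have "((\<integral>x. f x \<partial>unif) powr t * (\<integral>x. g x \<partial>unif) powr (1 - t)) / H \<le> (\<integral>x. h x \<partial>unif) / H"
    by linarith
  then show ?thesis using H by (simp add: divide_le_cancel)
qed

section \<open>Log-concavity of the uniform measure on the cube\<close>

abbreviation cube :: "nat \<Rightarrow> (nat \<Rightarrow> real) measure" where
  "cube n \<equiv> PiM {..<n} (\<lambda>_. unif)"

interpretation cube: product_sigma_finite "\<lambda>_::nat. unif" ..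

lemma prob_space_cube: "prob_space (cube n)"
  by (intro prob_space_PiM unif.prob_space_axioms)

lemma sets_cube: "sets (cube n) = sets (Rn_borel n)"
  unfolding Rn_borel_def by (intro sets_PiM_cong) auto

lemma space_cube: "space (cube n) = Rn n"
  by (simp add: space_PiM Rn_def)

definition slice :: "nat \<Rightarrow> (nat \<Rightarrow> real) set \<Rightarrow> real \<Rightarrow> (nat \<Rightarrow> real) set" where
  "slice n A y = {x \<in> space (cube n). x(n := y) \<in> A}"

lemma slice:
  assumes A: "A \<in> sets (cube (Suc n))"
  shows "slice n A y \<in> sets (cube n)"
    and "(\<lambda>y. measure (cube n) (slice n A y)) \<in> borel_measurable borel"
    and "measure (cube (Suc n)) A = (\<integral>y. measure (cube n) (slice n A y) \<partial>unif)"
proof -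
  interpret P: prob_space "cube n" by (rule prob_space_cube)
  interpret P': prob_space "cube (Suc n)" by (rule prob_space_cube)
  have ins: "{..<Suc n} = insert n {..<n}" by auto
  have up [measurable]: "(\<lambda>(x, y). x(n := y)) \<in> cube n \<Otimes>\<^sub>M unif \<rightarrow>\<^sub>M cube (Suc n)"
    unfolding ins by (rule measurable_add_dim)
  have up': "(\<lambda>p. (snd p)(n := fst p)) \<in> unif \<Otimes>\<^sub>M cube n \<rightarrow>\<^sub>M cube (Suc n)"
    using measurable_compose[OF measurable_pair_swap' up] by (simp add: case_prod_beta)
  define Q where "Q = {p \<in> space (unif \<Otimes>\<^sub>M cube n). (snd p)(n := fst p) \<in> A}"
  have Q: "Q \<in> sets (unif \<Otimes>\<^sub>M cube n)"
    using measurable_sets[OF up' A] by (simp add: Q_def vimage_def Int_def conj_commute)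
  have sl: "Pair y -` Q = slice n A y" for y
    by (auto simp: Q_def slice_def space_pair_measure)
  show s1: "slice n A y \<in> sets (cube n)" for y
    using sets_Pair1[OF Q, of y] by (simp add: sl)
  have "(\<lambda>y. emeasure (cube n) (slice n A y)) \<in> borel_measurable unif"
    using P.measurable_emeasure_Pair[OF Q] by (simp add: sl)
  then show s2: "(\<lambda>y. measure (cube n) (slice n A y)) \<in> borel_measurable borel"
    unfolding measure_def by measurable
  have "emeasure (cube (Suc n)) A = (\<integral>\<^sup>+x. indicator A x \<partial>PiM (insert n {..<n}) (\<lambda>_. unif))"
    using A by (simp add: ins)
  also have "\<dots> = (\<integral>\<^sup>+y. \<integral>\<^sup>+x. indicator A (x(n := y)) \<partial>cube n \<partial>unif)"
    using A by (intro cube.product_nn_integral_insert_rev) (auto simp: ins)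
  also have "\<dots> = (\<integral>\<^sup>+y. emeasure (cube n) (slice n A y) \<partial>unif)"
  proof (rule nn_integral_cong)
    fix y
    have "(\<integral>\<^sup>+x. indicator A (x(n := y)) \<partial>cube n) = (\<integral>\<^sup>+x. indicator (slice n A y) x \<partial>cube n)"
      by (intro nn_integral_cong) (auto simp: slice_def indicator_def)
    then show "(\<integral>\<^sup>+x. indicator A (x(n := y)) \<partial>cube n) = emeasure (cube n) (slice n A y)"
      using s1 by simp
  qed
  also have "\<dots> = (\<integral>\<^sup>+y. ennreal (measure (cube n) (slice n A y)) \<partial>unif)"
    by (simp add: P.emeasure_eq_measure)
  also have "\<dots> = ennreal (\<integral>y. measure (cube n) (slice n A y) \<partial>unif)"
    using s2 by (intro nn_integral_eq_integral integrable_unif[where c = 1]) auto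
  finally show "measure (cube (Suc n)) A = (\<integral>y. measure (cube n) (slice n A y) \<partial>unif)"
    by (simp add: P'.emeasure_eq_measure)
qed

lemma brunn_minkowski_cube:
  assumes "A \<in> sets (cube n)" "B \<in> sets (cube n)" "C \<in> sets (cube n)" and t: "0 < t" "t < 1"
    and "\<And>x y. x \<in> A \<Longrightarrow> y \<in> B \<Longrightarrow> restrict (\<lambda>i. t * x i + (1 - t) * y i) {..<n} \<in> C"
  shows "measure (cube n) A powr t * measure (cube n) B powr (1 - t) \<le> measure (cube n) C"
  using assms
proof (induction n arbitrary: A B C)
  case 0
  interpret P: prob_space "cube 0" by (rule prob_space_cube)
  show ?case
  proof (cases "A = {} \<or> B = {}")
    \<comment> \<open>The space is a single point in dimension 0, so two nonempty sets force
      \<open>C\<close> to be everything.\<close>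
    case False
    then obtain x y where "x \<in> A" "y \<in> B" by blast
    from 0(6)[OF this] have "space (cube 0) \<subseteq> C" by (simp add: space_PiM)
    then have "C = space (cube 0)" using sets.sets_into_space[OF 0(3)] by (rule subset_antisym[rotated])
    then have "measure (cube 0) C = 1" by (simp only: P.prob_space)
    moreover have "measure (cube 0) A powr t * measure (cube 0) B powr (1 - t) \<le> 1 * 1"
      using t P.prob_le_1 by (intro mult_mono powr_le1) auto
    ultimately show ?thesis by simp
  qed auto
next
  case (Suc n)
  interpret P: prob_space "cube n" by (rule prob_space_cube)
  show ?case
    unfolding slice(3)[OF Suc.prems(1)] slice(3)[OF Suc.prems(2)] slice(3)[OF Suc.prems(3)]
  proof (rule prekopa_leindler_unif)
    fix y1 y2
    show "measure (cube n) (slice n A y1) powr t * measure (cube n) (slice n B y2) powr (1 - t)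
        \<le> measure (cube n) (slice n C (t * y1 + (1 - t) * y2))"
    proof (rule Suc.IH)
      fix x x' assume "x \<in> slice n A y1" "x' \<in> slice n B y2"
      then have *: "x(n := y1) \<in> A" "x'(n := y2) \<in> B" by (auto simp: slice_def)
      have "restrict (\<lambda>i. t * (x(n := y1)) i + (1 - t) * (x'(n := y2)) i) {..<Suc n}
          = (restrict (\<lambda>i. t * x i + (1 - t) * x' i) {..<n})(n := t * y1 + (1 - t) * y2)"
        by (auto simp: fun_eq_iff restrict_def)
      then have "(restrict (\<lambda>i. t * x i + (1 - t) * x' i) {..<n})(n := t * y1 + (1 - t) * y2) \<in> C"
        using Suc.prems(6)[OF *] by (simp only:)
      then show "restrict (\<lambda>i. t * x i + (1 - t) * x' i) {..<n} \<in> slice n C (t * y1 + (1 - t) * y2)"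
        unfolding slice_def by (simp add: space_PiM del: fun_upd_restrict restrict_fupd)
    qed (use Suc.prems slice(1) in auto)
  qed (use Suc.prems slice(2) t in auto)
qed

text \<open>Links the product topology on all coordinates with the sigma-algebra of the first
  \<open>n\<close>: the inclusion is measurable because the other coordinates are constantly
  \<open>undefined\<close>.\<close>

lemma closed_in_sets_Rn_borel:
  assumes "closed K" "K \<subseteq> Rn n"
  shows "K \<in> sets (Rn_borel n)"
proof -
  have "(\<lambda>x. x) \<in> PiM {..<n} (\<lambda>_. borel :: real measure) \<rightarrow>\<^sub>M PiM UNIV (\<lambda>_. borel)"
  proof (rule measurable_PiM_single')
    fix i :: nat
    show "(\<lambda>x. x i) \<in> PiM {..<n} (\<lambda>_. borel :: real measure) \<rightarrow>\<^sub>M borel"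
    proof (cases "i < n")
      case False
      have "(\<lambda>x. undefined :: real) \<in> PiM {..<n} (\<lambda>_. borel :: real measure) \<rightarrow>\<^sub>M borel" by simp
      moreover have "undefined = x i" if "x \<in> space (PiM {..<n} (\<lambda>_. borel :: real measure))" for x
      proof -
        have "x i = undefined"
          by (rule PiE_arb[OF that[unfolded space_PiM]]) (use False in simp)
        then show ?thesis by (rule sym)
      qed
      ultimately show ?thesis by (rule measurable_cong[THEN iffD1, rotated])
    qed (simp add: measurable_component_singleton)
  qed auto
  then have m: "(\<lambda>x. x) \<in> PiM {..<n} (\<lambda>_. borel :: real measure) \<rightarrow>\<^sub>M borel"
    by (simp add: measurable_cong_sets[OF refl sets_PiM_equal_borel])
  have "(\<lambda>x. x) -` K \<inter> space (PiM {..<n} (\<lambda>_. borel :: real measure)) = K"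
    using assms by (auto simp: space_PiM Rn_def)
  then show ?thesis
    using measurable_sets[OF m borel_closed[OF assms(1)]] by (simp add: Rn_borel_def)
qed

lemma compact_mink_comb:
  assumes "compact A" "compact B"
  shows "compact (mink_comb n t A B)"
proof -
  have "mink_comb n t A B = (\<lambda>p. restrict (\<lambda>i. t * fst p i + (1 - t) * snd p i) {..<n}) ` (A \<times> B)"
    by (force simp: mink_comb_def)
  moreover have "continuous_on (A \<times> B) (\<lambda>p. restrict (\<lambda>i. t * fst p i + (1 - t) * snd p i) {..<n})"
  proof (rule continuous_on_coordinatewise_then_product)
    fix i
    have "continuous_on (A \<times> B) (\<lambda>p. t * fst p i + (1 - t) * snd p i)"
      by (intro continuous_intros continuous_on_product_then_coordinatewise)
    then show "continuous_on (A \<times> B) (\<lambda>p. restrict (\<lambda>i. t * fst p i + (1 - t) * snd p i) {..<n} i)"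
      by (cases "i < n") auto
  qed
  ultimately show ?thesis using assms by (auto intro: compact_continuous_image compact_Times)
qed

text \<open>Fubini in a coordinate with \<open>a i \<noteq> 0\<close>: a line in that direction
  meets the hyperplane at most in \<open>y0\<close>.\<close>

lemma measure_cube_hyperplane:
  assumes i: "i < n" and ai: "a i \<noteq> 0"
  shows "measure (cube n) (hyperplane n a b) = 0"
proof -
  let ?I = "{..<n} - {i}"
  have ins: "{..<n} = insert i ?I" using i by auto
  have "hyperplane n a b = {x \<in> space (cube n). (\<Sum>i<n. a i * x i) = b}"
    by (simp add: hyperplane_def space_cube)
  also have "\<dots> \<in> sets (cube n)" by measurable
  finally have H: "hyperplane n a b \<in> sets (cube n)" .
  have "emeasure (cube n) (hyperplane n a b) = (\<integral>\<^sup>+x. indicator (hyperplane n a b) x \<partial>PiM (insert i ?I) (\<lambda>_. unif))"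
    using H ins by simp
  also have "\<dots> = (\<integral>\<^sup>+x. \<integral>\<^sup>+y. indicator (hyperplane n a b) (x(i := y)) \<partial>unif \<partial>PiM ?I (\<lambda>_. unif))"
    using H ins by (intro cube.product_nn_integral_insert) auto
  also have "\<dots> = (\<integral>\<^sup>+x. 0 \<partial>PiM ?I (\<lambda>_. unif))"
  proof (rule nn_integral_cong)
    fix x
    define y0 where "y0 = (b - (\<Sum>j\<in>?I. a j * x j)) / a i"
    have "y = y0" if "x(i := y) \<in> hyperplane n a b" for y
    proof -
      have "b = (\<Sum>j<n. a j * (x(i := y)) j)" using that by (simp add: hyperplane_def)
      also have "\<dots> = a i * y + (\<Sum>j\<in>?I. a j * (x(i := y)) j)"
        using i by (subst sum.remove[of _ i]) auto
      also have "(\<Sum>j\<in>?I. a j * (x(i := y)) j) = (\<Sum>j\<in>?I. a j * x j)"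
        by (intro sum.cong) auto
      finally show ?thesis using ai by (simp add: y0_def field_simps)
    qed
    then have "(\<integral>\<^sup>+y. indicator (hyperplane n a b) (x(i := y)) \<partial>unif) \<le> (\<integral>\<^sup>+y. indicator {y0} y \<partial>unif)"
      by (intro nn_integral_mono) (auto simp: indicator_def)
    also have "\<dots> = emeasure unif {y0}" by simp
    also have "\<dots> \<le> 0" 
    proof -
      have "emeasure lborel ({0..1} \<inter> {y0}) \<le> emeasure lborel {y0}" by (intro emeasure_mono) auto
      then show ?thesis by (simp add: emeasure_unif)
    qed
    finally show "(\<integral>\<^sup>+y. indicator (hyperplane n a b) (x(i := y)) \<partial>unif) = 0" by simp
  qed
  finally show ?thesis by (simp add: measure_def)
qed

lemma log_concave_measure_cube: "log_concave_measure n (cube n)"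
  unfolding log_concave_measure_def
proof (intro conjI allI impI)
  show "prob_space (cube n)" by (rule prob_space_cube)
  show "sets (cube n) = sets (Rn_borel n)" by (rule sets_cube)
  fix A B :: "(nat \<Rightarrow> real) set" and t :: real
  assume *: "compact A" "compact B" "A \<subseteq> Rn n" "B \<subseteq> Rn n" "0 < t" "t < 1"
  show "measure (cube n) A powr t * measure (cube n) B powr (1 - t) \<le> measure (cube n) (mink_comb n t A B)"
  proof (rule brunn_minkowski_cube)
    have "mink_comb n t A B \<subseteq> Rn n" by (auto simp: mink_comb_def Rn_eq)
    then show "mink_comb n t A B \<in> sets (cube n)"
      using * by (auto simp: sets_cube intro!: closed_in_sets_Rn_borel compact_imp_closed compact_mink_comb)
    show "A \<in> sets (cube n)" "B \<in> sets (cube n)"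
      using * by (auto simp: sets_cube intro!: closed_in_sets_Rn_borel compact_imp_closed)
  qed (use * in \<open>auto simp: mink_comb_def\<close>)
next
  fix a :: "nat \<Rightarrow> real" and b :: real
  assume "\<exists>i<n. a i \<noteq> 0"
  then show "measure (cube n) (hyperplane n a b) < 1" using measure_cube_hyperplane by auto
qed

section \<open>The limit\<close>

text \<open>The grid bound with worst-case parameters: \<open>14 n ln n\<close> bounds the logarithm
  of the number of targets, \<open>8 n ln n\<close> bounds \<open>- ln \<eta>\<close>,
  \<open>1 / n\<close> dominates \<open>\<kappa>\<close>, and \<open>1 / n^3\<close> is
  \<open>\<tau>\<close>. The double exponential bounds \<open>(1 - \<eta>)^N\<close>.\<close>

definition hull_lower :: "nat \<Rightarrow> real" where
  "hull_lower n = (1 - exp (14 * (real n * ln (real n))) *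
       exp (- (exp (- 8 * (real n * ln (real n))) * exp ((real n * ln (real n))\<^sup>2)))) *
     ((1 - 1 / real n) * exp (- 8 * (real n * ln (real n)) / real n ^ 3))"

lemma hull_lower_tendsto: "hull_lower \<longlonglongrightarrow> 1"
  unfolding hull_lower_def by real_asymp

lemma hull_error_le_1:
  "eventually (\<lambda>n. exp (14 * (real n * ln (real n))) *
     exp (- (exp (- 8 * (real n * ln (real n))) * exp ((real n * ln (real n))\<^sup>2))) \<le> 1) sequentially"
  by real_asymp

lemma expected_hull_measure_lower:
  "eventually (\<lambda>n. \<forall>\<mu> N. log_concave_measure n \<mu> \<longrightarrow> exp ((real n * ln (real n))\<^sup>2) \<le> real N \<longrightarrow>
     hull_lower n \<le> expected_hull_measure n \<mu> N) sequentially"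
proof -
  obtain q :: nat where q0: "0 < q" and q: "\<And>M n a b. log_concave_space M n \<Longrightarrow>
     integral\<^sup>L M (affine_form n a b) = 0 \<Longrightarrow> integral\<^sup>L M (\<lambda>w. (affine_form n a b w)\<^sup>2) = 1 \<Longrightarrow>
     1 / (real q)\<^sup>2 \<le> measure M {w \<in> space M. 1 / real q \<le> affine_form n a b w}"
    using exists_one_sided_const by blast
  have "hull_lower n \<le> expected_hull_measure n \<mu> N"
    if n: "288 * q\<^sup>2 \<le> n"
      and err: "exp (14 * (real n * ln (real n))) *
        exp (- (exp (- 8 * (real n * ln (real n))) * exp ((real n * ln (real n))\<^sup>2))) \<le> 1"
      and lc: "log_concave_measure n \<mu>" and N: "exp ((real n * ln (real n))\<^sup>2) \<le> real N" for n \<mu> N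
  proof -
    have lcs: "log_concave_space \<mu> n"
      using lc by (simp add: log_concave_space_def log_concave_space_axioms_def log_concave_measure_def)
    interpret log_concave_space \<mu> n by (rule lcs)
    obtain a b where ab': "\<forall>j<n. expectation (affine_form n (a j) (b j)) = 0"
      "\<forall>i<n. \<forall>j<n. expectation (\<lambda>w. affine_form n (a i) (b i) w * affine_form n (a j) (b j) w)
         = (if i = j then 1 else 0)"
      "\<forall>\<theta>. \<exists>t c. \<forall>x. (\<Sum>i<n. \<theta> i * x i) = c + (\<Sum>j<n. t j * affine_form n (a j) (b j) x)"
      using exists_orthonormal_forms by (elim exE conjE)
    note ab = ab'(1,2)[rule_format] ab'(3)[THEN spec]
    have q1: "1 \<le> real q" using q0 by simp
    have qn: "288 * (real q)\<^sup>2 \<le> real n" using n by (metis of_nat_le_iff of_nat_mult of_nat_numeral of_nat_power)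
    have "1 \<le> (real q)\<^sup>2" using q1 by simp
    then have n288: "288 \<le> real n" using qn by linarith
    define s \<kappa> \<tau> r L where "s = 1 / real q" and "\<kappa> = 1 / (64 * (real q)\<^sup>2 * (real n)\<^sup>2)"
      and "\<tau> = 1 / real n ^ 3" and "r = 1 / (12 * real q * real n ^ 4)" and "L = 12 * real q * (real n)\<^sup>2"
    define J where "J = 144 * q\<^sup>2 * n ^ 6"
    define \<eta> where "\<eta> = \<kappa> / (2 * real (2 * J) ^ n)"
    have \<kappa>0: "0 < \<kappa>" using q1 n288 by (simp add: \<kappa>_def)
    have J0: "0 < real (2 * J)" using q1 n288 by (simp add: J_def)
    have \<eta>0: "0 < \<eta>" using \<kappa>0 J0 by (simp add: \<eta>_def)
    interpret grid \<mu> n a b s \<kappa> \<tau> r L \<eta> J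
    proof
      show "0 < n" using n288 by simp
      show "s\<^sup>2 \<le> prob {w \<in> space \<mu>. s \<le> affine_form n \<alpha> \<beta> w}"
        if "expectation (affine_form n \<alpha> \<beta>) = 0" "expectation (\<lambda>w. (affine_form n \<alpha> \<beta> w)\<^sup>2) = 1" for \<alpha> \<beta>
        using q[OF lcs that] by (simp add: s_def power_one_over)
      show "0 < s" "s \<le> 1" using q1 by (auto simp: s_def)
      have "\<kappa> = (s / (8 * real n))\<^sup>2"
        by (simp add: \<kappa>_def s_def power_divide power_mult_distrib)
      then have "sqrt \<kappa> = s / (8 * real n)" using \<open>0 < s\<close> by (simp add: real_sqrt_abs)
      then show "sqrt \<kappa> \<le> s / (8 * real n)" by simp
      show "0 < \<tau>" "\<tau> < 1" using n288 by (auto simp: \<tau>_def)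
      show "r = \<tau> * s / (12 * real n)" by (simp add: r_def \<tau>_def s_def eval_nat_numeral)
      show "0 < L" using q1 n288 by (simp add: L_def)
      show "L \<le> real J * r"
        using q1 n288 by (simp add: L_def J_def r_def field_simps eval_nat_numeral)
      have "real n / L\<^sup>2 = 1 / (144 * (real q)\<^sup>2 * real n ^ 3)"
        using n288 by (simp add: L_def power_mult_distrib field_simps eval_nat_numeral)
      also have "\<dots> \<le> 1 / (128 * (real q)\<^sup>2 * (real n)\<^sup>2)"
        using q1 n288 by (intro divide_left_mono mult_mono power_increasing) auto
      finally show "real n / L\<^sup>2 \<le> \<kappa> / 2" by (simp add: \<kappa>_def)
      show "0 < \<eta>" by (rule \<eta>0)
      show "real (2 * J) ^ n * \<eta> \<le> \<kappa> / 2" using J0 by (simp add: \<eta>_def)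
    qed (fact \<kappa>0 ab)+
    define E where "E = real n * ln (real n)"
    have npow: "real n ^ k = exp (real k * ln (real n))" for k
      using n288 by (simp add: exp_of_nat_mult)
    \<comment> \<open>\<open>2 J = 288 q^2 n^6\<close>; the condition \<open>288 q^2 <= n\<close>
      absorbs the constants into one more power of \<open>n\<close>.\<close>
    have J7: "real (2 * J) \<le> real n ^ 7"
    proof -
      have "real (2 * J) = 288 * (real q)\<^sup>2 * real n ^ 6" by (simp add: J_def)
      also have "\<dots> \<le> real n * real n ^ 6" using qn by (intro mult_right_mono) auto
      finally show ?thesis by (simp add: eval_nat_numeral)
    qed
    have J_le: "real (2 * J) ^ k \<le> real n ^ (7 * k)" for k
      unfolding power_mult[of _ 7] using J7 by (rule power_mono) simp
    have X: "real (2 * J) ^ (2 * n) \<le> exp (14 * E)"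
    proof -
      have "real n ^ (7 * (2 * n)) = exp (14 * E)" unfolding npow by (simp add: E_def)
      then show ?thesis using J_le[of "2 * n"] by (simp only:)
    qed
    \<comment> \<open>\<open>1 / \<eta> = 128 q^2 n^2 (2 J)^n\<close> with
      \<open>128 q^2 <= n\<close>, and the resulting \<open>n^(7 n + 3)\<close> is at most
      \<open>n^(8 n)\<close>.\<close>
    have \<eta>_ge: "exp (- 8 * E) \<le> \<eta>"
    proof -
      have "128 * (real q)\<^sup>2 * (real n)\<^sup>2 * real (2 * J) ^ n \<le> real n * (real n)\<^sup>2 * real n ^ (7 * n)"
        using qn J_le[of n] J0 by (intro mult_mono) auto
      also have "\<dots> = real n ^ (7 * n + 3)" by (simp add: power_add eval_nat_numeral)
      also have "\<dots> \<le> real n ^ (8 * n)" using n288 by (intro power_increasing) auto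
      also have "\<dots> = exp (8 * E)" by (simp add: npow E_def mult_ac)
      finally have "1 / exp (8 * E) \<le> 1 / (128 * (real q)\<^sup>2 * (real n)\<^sup>2 * real (2 * J) ^ n)"
        using q1 n288 J0 by (intro divide_left_mono) auto
      then show ?thesis by (simp add: \<eta>_def \<kappa>_def exp_minus inverse_eq_divide)
    qed
    have \<eta>1: "\<eta> \<le> 1" using prob_box_centre prob_le_1 order_trans by blast
    have "(1 - \<eta>) ^ N \<le> exp (- \<eta>) ^ N"
      using \<eta>1 exp_ge_add_one_self[of "- \<eta>"] by (intro power_mono) auto
    also have "\<dots> = exp (- (\<eta> * real N))" by (simp add: exp_of_nat_mult[symmetric] mult.commute)
    also have "\<dots> \<le> exp (- (exp (- 8 * E) * exp (E\<^sup>2)))"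
      using \<eta>_ge \<eta>0 N by (intro iffD2[OF exp_le_cancel_iff] le_imp_neg_le mult_mono) (auto simp: E_def)
    finally have "real (2 * J) ^ (2 * n) * (1 - \<eta>) ^ N \<le> exp (14 * E) * exp (- (exp (- 8 * E) * exp (E\<^sup>2)))"
      using X \<eta>1 by (intro mult_mono) auto
    note err' = this
    have le1: "real (2 * J) ^ (2 * n) * (1 - \<eta>) ^ N \<le> 1"
      using err' err unfolding E_def by linarith
    have "hull_lower n = (1 - exp (14 * E) * exp (- (exp (- 8 * E) * exp (E\<^sup>2)))) *
        ((1 - 1 / real n) * exp (- 8 * E / real n ^ 3))"
      by (simp add: hull_lower_def E_def)
    also have "\<dots> \<le> (1 - real (2 * J) ^ (2 * n) * (1 - \<eta>) ^ N) * ((1 - \<kappa>) * \<eta> powr \<tau>)"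
    proof (intro mult_mono)
      show "1 - exp (14 * E) * exp (- (exp (- 8 * E) * exp (E\<^sup>2))) \<le> 1 - real (2 * J) ^ (2 * n) * (1 - \<eta>) ^ N"
        using err' by simp
      have "1 * 1 \<le> (64 * (real q)\<^sup>2) * real n"
        using \<open>1 \<le> (real q)\<^sup>2\<close> n288 by (intro mult_mono) linarith+
      then have "1 * real n \<le> (64 * (real q)\<^sup>2 * real n) * real n"
        by (intro mult_right_mono) auto
      then have "1 / (64 * (real q)\<^sup>2 * real n * real n) \<le> 1 / real n"
        using n288 q1 by (intro divide_left_mono) auto
      then show "1 - 1 / real n \<le> 1 - \<kappa>" by (simp add: \<kappa>_def power2_eq_square mult_ac)
      have "exp (- 8 * E / real n ^ 3) = exp (- 8 * E) powr \<tau>"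
        by (simp add: powr_def \<tau>_def)
      also have "\<dots> \<le> \<eta> powr \<tau>" using \<eta>_ge by (intro powr_mono2) (auto simp: \<tau>_def)
      finally show "exp (- 8 * E / real n ^ 3) \<le> \<eta> powr \<tau>" .
      show "0 \<le> 1 - \<kappa>" using \<kappa>_bounds by simp
      show "0 \<le> (1 - 1 / real n) * exp (- 8 * E / real n ^ 3)" using n288 by simp
    qed (use le1 in auto)
    also have "\<dots> \<le> expected_hull_measure n \<mu> N" by (rule expected_hull_measure_grid[OF le1])
    finally show ?thesis .
  qed
  then show ?thesis
    using eventually_conj[OF eventually_ge_at_top[of "288 * q\<^sup>2"] hull_error_le_1]
    by (auto elim!: eventually_mono)
qed

section \<open>Passage to the infima\<close>

lemma expected_hull_measure_bounds:
  assumes "prob_space \<mu>"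
  shows "0 \<le> expected_hull_measure n \<mu> N" "expected_hull_measure n \<mu> N \<le> 1"
proof -
  interpret prob_space \<mu> by fact
  interpret P: prob_space "PiM {..<N} (\<lambda>_. \<mu>)" by (intro prob_space_PiM assms)
  show "0 \<le> expected_hull_measure n \<mu> N" by (simp add: expected_hull_measure_def)
  have "(\<integral>X. prob (conv_pts n N X) \<partial>PiM {..<N} (\<lambda>_. \<mu>)) \<le> 1"
  proof (cases "integrable (PiM {..<N} (\<lambda>_. \<mu>)) (\<lambda>X. prob (conv_pts n N X))")
    case True
    then show ?thesis by (intro P.integral_le_const) auto
  next
    \<comment> \<open>The integral of a non-integrable function is 0 by convention.\<close>
    case False
    then show ?thesis by (simp add: not_integrable_integral_eq)
  qed
  then show "expected_hull_measure n \<mu> N \<le> 1" by (simp add: expected_hull_measure_def)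
qed

theorem theorem5p8:
  shows "\<exists>C>0. \<forall>u :: nat \<Rightarrow> real. (\<forall>n. 0 < u n) \<longrightarrow> filterlim u at_top sequentially \<longrightarrow>
    ((\<lambda>n. INF \<mu>\<in>{\<mu>. log_concave_measure n \<mu>}.
        INF N\<in>{N::nat. real N \<ge> exp (C * (real n * ln (real n))^2 * u n)}.
          expected_hull_measure n \<mu> N) \<longlonglongrightarrow> 1)"
proof (intro exI[of _ 1] conjI allI impI)
  fix u :: "nat \<Rightarrow> real"
  assume u: "filterlim u at_top sequentially"
  define S where "S n = {N::nat. real N \<ge> exp (1 * (real n * ln (real n))^2 * u n)}" for n
  define I where "I n \<mu> = (INF N\<in>S n. expected_hull_measure n \<mu> N)" for n \<mu>
  have ne: "S n \<noteq> {}" for n unfolding S_def using real_arch_simple by blast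
  have ps: "prob_space \<mu>" if "log_concave_measure n \<mu>" for n \<mu>
    using that by (simp add: log_concave_measure_def)
  have I0: "0 \<le> I n \<mu>" if "log_concave_measure n \<mu>" for n \<mu>
    unfolding I_def using ne expected_hull_measure_bounds[OF ps[OF that]] by (intro cINF_greatest) auto
  have upper: "(INF \<mu>\<in>{\<mu>. log_concave_measure n \<mu>}. I n \<mu>) \<le> 1" for n
  proof -
    have bd: "bdd_below (I n ` {\<mu>. log_concave_measure n \<mu>})"
      using I0 by (intro bdd_belowI[of _ 0]) auto
    obtain N where N: "N \<in> S n" using ne by blast
    have bd': "bdd_below (expected_hull_measure n (cube n) ` S n)"
      using expected_hull_measure_bounds[OF prob_space_cube] by (intro bdd_belowI[of _ 0]) auto
    have "(INF \<mu>\<in>{\<mu>. log_concave_measure n \<mu>}. I n \<mu>) \<le> I n (cube n)"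
      using log_concave_measure_cube by (intro cINF_lower[OF bd]) auto
    also have "\<dots> \<le> expected_hull_measure n (cube n) N"
      unfolding I_def by (rule cINF_lower[OF bd' N])
    also have "\<dots> \<le> 1" by (rule expected_hull_measure_bounds[OF prob_space_cube])
    finally show ?thesis .
  qed
  \<comment> \<open>With \<open>C = 1\<close>, \<open>u n >= 1\<close> gives samples of size at
    least \<open>exp ((n ln n)^2)\<close>, which far exceeds
    \<open>1 / \<eta> <= exp (8 n ln n)\<close>.\<close>
  have "eventually (\<lambda>n. 1 \<le> u n) sequentially" using u by (simp add: filterlim_at_top)
  then have lower: "eventually (\<lambda>n. hull_lower n \<le> (INF \<mu>\<in>{\<mu>. log_concave_measure n \<mu>}. I n \<mu>)) sequentially"
    using expected_hull_measure_lower
  proof eventually_elim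
    case (elim n)
    have "exp ((real n * ln (real n))\<^sup>2) \<le> real N" if "N \<in> S n" for N
    proof -
      have "(real n * ln (real n))\<^sup>2 * 1 \<le> (real n * ln (real n))\<^sup>2 * u n"
        using elim(1) by (intro mult_left_mono) auto
      then have "exp ((real n * ln (real n))\<^sup>2) \<le> exp (1 * (real n * ln (real n))^2 * u n)" by simp
      also have "\<dots> \<le> real N" using that by (simp add: S_def)
      finally show ?thesis .
    qed
    then have "hull_lower n \<le> I n \<mu>" if "log_concave_measure n \<mu>" for \<mu>
      unfolding I_def using elim(2) that ne by (intro cINF_greatest) auto
    then show ?case
      using log_concave_measure_cube[of n] by (intro cINF_greatest) auto
  qed
  have "(\<lambda>n. INF \<mu>\<in>{\<mu>. log_concave_measure n \<mu>}. I n \<mu>) \<longlonglongrightarrow> 1"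
    by (rule tendsto_sandwich[OF lower _ hull_lower_tendsto tendsto_const]) (use upper in auto)
  then show "(\<lambda>n. INF \<mu>\<in>{\<mu>. log_concave_measure n \<mu>}.
        INF N\<in>{N::nat. real N \<ge> exp (1 * (real n * ln (real n))^2 * u n)}.
          expected_hull_measure n \<mu> N) \<longlonglongrightarrow> 1"
    unfolding I_def S_def .
qed simp

end
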